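(* Let $X$ be a real-valued standard Markov process with no negative jumps, let $\alpha>0$, let $G_\alpha$ be its $\alpha$-Green kernel, and let $g\colon\mathbb{R}\to[0,\infty)$ be a continuous function that belongs to the domain $\mathcal{D}_\alpha$ of the extended infinitesimal generator $A_\alpha$ of the $\alpha$-killed process. Write $f=(\alpha-A)g:=-A_\alpha g$, and suppose that for all $x\in\mathbb{R}$ (i) $\lim_{t\to\infty}\mathbb{E}_x\left(e^{-\alpha t}g(X_t)\right)=0$, (ii) $\mathbb{E}_x\left(\int_0^\infty e^{-\alpha s}|f(X_s)|\,ds\right)<\infty$. Suppose that $x^*\in\mathbb{R}$ is a solution of $$g(x^* )=\int_{x^*}^\infty(\alpha-A)g(y)\,G_\alpha(x^*,dy)$$ such that $(\alpha-A)g(y)\ge 0$ for all $y\ge x^*$. Define, for $x\in\mathbb{R}$, $$V_\alpha(x)=\int_{x^*}^\infty(\alpha-A)g(y)\,G_\alpha(x,dy).$$ If $V_\alpha(x)\ge g(x)$ for all $x\le x^*$, then the optimal stopping problem with reward $g$ and discount $\alpha$ is right-sided, $x^*$ is an optimal threshold and $V_\alpha$ is the value function; that is, with $\tau^*=\inf\{t\ge0\colon X_t\ge x^*\}$, for every $x\in\mathbb{R}$, $$V_\alpha(x)=\sup_{\tau}\mathbb{E}_x\left(e^{-\alpha\tau}g(X_\tau)\right)=\mathbb{E}_x\left(e^{-\alpha\tau^*}g(X_{\tau^*})\right),$$ where the supremum is over all stopping times $\tau$ with respect to the filtration $\{\mathcal{F}_t\}$.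
   Context: A standard Markov process is a real-valued, time-homogeneous, non-terminating (infinite lifetime) strong Markov process $X=(\{X_t\}_{t\ge0},\{\mathcal{F}_t\}_{t\ge 0},\{\mathbb{P}_x\}_{x\in\mathbb{R}})$ on a space $(\Omega,\mathcal{F})$, with $X_0=x$ under $\mathbb{P}_x$ and state space $\mathbb{R}$, which is adapted (progressively measurable), has càdlàg paths, and is left-quasi-continuous: for every stopping time $\tau$, $X_\tau$ is $\mathcal{F}_\tau$-measurable, and for every non-decreasing sequence of stopping times $\tau_n\to\tau$ one has $X_{\tau_n}\to X_\tau$ $\mathbb{P}_x$-a.s. on $\{\tau<\infty\}$, for all $x\in\mathbb{R}$. The filtration $\{\mathcal{F}_t\}$ is right-continuous and each $\mathcal{F}_t$ is $\mathbb{P}_x$-complete for all $x$. $\mathbb{E}_x$ is expectation under $\mathbb{P}_x$. A stopping time is a random variable $\tau$ with values in $[0,\infty]$ such that $\{\tau<t\}\in\mathcal{F}_t$ for all $t\ge 0$. No negative jumps means $\Delta X_t=X_t-\lim_{s\to t^-}X_s\ge 0$ for all $t$. The $\alpha$-Green kernel is $G_\alpha(x,H)=\int_0^\infty e^{-\alpha t}\,\mathbb{P}_x(X_t\in H)\,dt$ for $x\in\mathbb{R}$ and $H\subseteq\mathbb{R}$ Borel. The $\alpha$-killed process is $X$ killed at an independent exponential time of parameter $\alpha$. A Borel function $h\colon\mathbb{R}\to\mathbb{R}$ belongs to the domain $\mathcal{D}_\alpha$ of its extended infinitesimal generator if there is a Borel function $A_\alpha h\colon\mathbb{R}\to\mathbb{R}$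 such that $\int_0^t|A_\alpha h(X_s)|\,ds<\infty$ almost surely for every $t$ and $$e^{-\alpha t}h(X_t)-h(X_0)-\int_0^t e^{-\alpha s}A_\alpha h(X_s)\,ds$$ is a right-continuous martingale with respect to $\{\mathcal{F}_t\}$ and $\mathbb{P}_x$, for every $x\in\mathbb{R}$. (If $h$ is in the domain of the extended infinitesimal generator $A$ of $X$ itself, then $A_\alpha h=Ah-\alpha h$; this motivates the notation $(\alpha-A)h=-A_\alpha h$.) Conventions: $\int_{x^*}^\infty$ denotes integration over $[x^*,\infty)$, and $e^{-\alpha\tau}g(X_\tau)=0$ on $\{\tau=\infty\}$. *)

theory Defs
  imports "HOL-Probability.Probability"
begin

(* Time is real and only indices t >= 0 matter: F t and X t are unconstrained for t < 0.
   Random times take values in [0,\<infinity>], modelled as ennreal. *)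

definition is_stopping_time :: "(real \<Rightarrow> 'a measure) \<Rightarrow> ('a \<Rightarrow> ennreal) \<Rightarrow> bool" where
  "is_stopping_time F \<tau> \<longleftrightarrow>
     (\<forall>t\<ge>0. {\<omega> \<in> space (F t). \<tau> \<omega> < ennreal t} \<in> sets (F t))"

(* The sigma-algebra of events up to \<tau>, with the same strict inequality as in
   is_stopping_time; for a right-continuous filtration the non-strict one gives the same sets. *)
definition stopped_algebra ::
    "'a measure \<Rightarrow> (real \<Rightarrow> 'a measure) \<Rightarrow> ('a \<Rightarrow> ennreal) \<Rightarrow> 'a measure" where
  "stopped_algebra M F \<tau> =
     sigma (space M) {A \<in> sets M. \<forall>t\<ge>0. {\<omega> \<in> A. \<tau> \<omega> < ennreal t} \<in> sets (F t)}"

(* Only meaningful where \<tau> is finite. *)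
definition at_time :: "(real \<Rightarrow> 'a \<Rightarrow> real) \<Rightarrow> ('a \<Rightarrow> ennreal) \<Rightarrow> 'a \<Rightarrow> real" where
  "at_time X \<tau> \<omega> = X (enn2real (\<tau> \<omega>)) \<omega>"

definition transition_prob ::
    "(real \<Rightarrow> 'a measure) \<Rightarrow> (real \<Rightarrow> 'a \<Rightarrow> real) \<Rightarrow> real \<Rightarrow> real \<Rightarrow> real set \<Rightarrow> real" where
  "transition_prob P X t x H = measure (P x) {\<omega> \<in> space (P x). X t \<omega> \<in> H}"

(* M carries only the measurable space; its measure is irrelevant.

   complete: the null sets are those that are null under every P x. Requiring the
   null sets of each single P x instead would, because the P x are mutually singular
   (X 0 = x holds P x-a.s.), force F 0 to contain all subsets of the sample space. *)
locale standard_markov_process =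
  fixes M :: "'a measure"
    and F :: "real \<Rightarrow> 'a measure"
    and P :: "real \<Rightarrow> 'a measure"
    and X :: "real \<Rightarrow> 'a \<Rightarrow> real"
  assumes prob_space_P: "prob_space (P x)"
    and sets_P: "sets (P x) = sets M"
    and subalgebra_F: "0 \<le> t \<Longrightarrow> subalgebra M (F t)"
    and mono_F: "0 \<le> s \<Longrightarrow> s \<le> t \<Longrightarrow> sets (F s) \<subseteq> sets (F t)"
    and right_continuous_F: "0 \<le> t \<Longrightarrow> sets (F t) = (\<Inter>s\<in>{t<..}. sets (F s))"
    and complete: "\<lbrakk>0 \<le> t; \<And>x. \<exists>N\<in>null_sets (P x). A \<subseteq> N\<rbrakk> \<Longrightarrow> A \<in> sets (F t)"
    and progressive: "0 \<le> t \<Longrightarrow>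
      (\<lambda>(s, \<omega>). X s \<omega>) \<in> restrict_space borel {0..t} \<Otimes>\<^sub>M F t \<rightarrow>\<^sub>M borel"
    and start: "AE \<omega> in P x. X 0 \<omega> = x"
    and right_continuous_paths:
      "\<lbrakk>\<omega> \<in> space M; 0 \<le> t\<rbrakk> \<Longrightarrow> ((\<lambda>s. X s \<omega>) \<longlongrightarrow> X t \<omega>) (at_right t)"
    and left_limits: "\<lbrakk>\<omega> \<in> space M; 0 < t\<rbrakk> \<Longrightarrow> \<exists>l. ((\<lambda>s. X s \<omega>) \<longlongrightarrow> l) (at_left t)"
    and borel_transition: "\<lbrakk>0 \<le> t; H \<in> sets borel\<rbrakk> \<Longrightarrow>
      (\<lambda>x. transition_prob P X t x H) \<in> borel_measurable borel"
    and stopped_measurable: "\<lbrakk>is_stopping_time F \<tau>; H \<in> sets borel\<rbrakk> \<Longrightarrow>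
      {\<omega> \<in> space M. \<tau> \<omega> < \<infinity> \<and> at_time X \<tau> \<omega> \<in> H} \<in> sets (stopped_algebra M F \<tau>)"
    and strong_markov: "\<lbrakk>is_stopping_time F \<tau>; 0 \<le> t; H \<in> sets borel\<rbrakk> \<Longrightarrow>
      AE \<omega> in P x. \<tau> \<omega> < \<infinity> \<longrightarrow>
        real_cond_exp (P x) (stopped_algebra M F \<tau>)
          (indicator {\<omega>' \<in> space M. \<tau> \<omega>' < \<infinity> \<and> at_time X (\<lambda>\<omega>. \<tau> \<omega> + ennreal t) \<omega>' \<in> H}) \<omega>
        = transition_prob P X t (at_time X \<tau> \<omega>) H"
    and left_quasi_continuous:
      "\<lbrakk>\<And>n. is_stopping_time F (T n); is_stopping_time F \<tau>;
        \<And>\<omega>. \<omega> \<in> space M \<Longrightarrow> incseq (\<lambda>n. T n \<omega>);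
        \<And>\<omega>. \<omega> \<in> space M \<Longrightarrow> (\<lambda>n. T n \<omega>) \<longlonglongrightarrow> \<tau> \<omega>\<rbrakk> \<Longrightarrow>
      AE \<omega> in P x. \<tau> \<omega> < \<infinity> \<longrightarrow> (\<lambda>n. at_time X (T n) \<omega>) \<longlonglongrightarrow> at_time X \<tau> \<omega>"

definition no_negative_jumps :: "'a measure \<Rightarrow> (real \<Rightarrow> 'a \<Rightarrow> real) \<Rightarrow> bool" where
  "no_negative_jumps M X \<longleftrightarrow>
     (\<forall>\<omega>\<in>space M. \<forall>t>0. X t \<omega> - Lim (at_left t) (\<lambda>s. X s \<omega>) \<ge> 0)"

definition green_kernel ::
    "(real \<Rightarrow> 'a measure) \<Rightarrow> (real \<Rightarrow> 'a \<Rightarrow> real) \<Rightarrow> real \<Rightarrow> real \<Rightarrow> real measure" where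
  "green_kernel P X \<alpha> x = measure_of UNIV (sets borel)
     (\<lambda>H. \<integral>\<^sup>+t\<in>{0..}. ennreal (exp (- \<alpha> * t) * transition_prob P X t x H) \<partial>lborel)"

definition right_continuous_martingale ::
    "'a measure \<Rightarrow> (real \<Rightarrow> 'a measure) \<Rightarrow> (real \<Rightarrow> 'a \<Rightarrow> real) \<Rightarrow> bool" where
  "right_continuous_martingale N F Y \<longleftrightarrow>
     (\<forall>t\<ge>0. Y t \<in> borel_measurable (F t) \<and> integrable N (Y t)) \<and>
     (\<forall>s\<ge>0. \<forall>t\<ge>s. AE \<omega> in N. real_cond_exp N (F s) (Y t) \<omega> = Y s \<omega>) \<and>
     (AE \<omega> in N. \<forall>t\<ge>0. ((\<lambda>s. Y s \<omega>) \<longlongrightarrow> Y t \<omega>) (at_right t))"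

(* "h belongs to the domain, and a is a version of A_\<alpha> h". This is a relation because
   the generator is determined only up to a set of potential zero. *)
definition killed_generator ::
    "(real \<Rightarrow> 'a measure) \<Rightarrow> (real \<Rightarrow> 'a measure) \<Rightarrow> (real \<Rightarrow> 'a \<Rightarrow> real) \<Rightarrow> real \<Rightarrow>
     (real \<Rightarrow> real) \<Rightarrow> (real \<Rightarrow> real) \<Rightarrow> bool" where
  "killed_generator F P X \<alpha> h a \<longleftrightarrow>
     h \<in> borel_measurable borel \<and> a \<in> borel_measurable borel \<and>
     (\<forall>x. \<forall>t\<ge>0. AE \<omega> in P x. (\<integral>\<^sup>+s\<in>{0..t}. ennreal \<bar>a (X s \<omega>)\<bar> \<partial>lborel) < \<infinity>) \<and>
     (\<forall>x. right_continuous_martingale (P x) F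
        (\<lambda>t \<omega>. exp (- \<alpha> * t) * h (X t \<omega>) - h (X 0 \<omega>)
               - (LINT s:{0..t}|lborel. exp (- \<alpha> * s) * a (X s \<omega>))))"

definition discounted_reward ::
    "(real \<Rightarrow> 'a \<Rightarrow> real) \<Rightarrow> real \<Rightarrow> (real \<Rightarrow> real) \<Rightarrow> ('a \<Rightarrow> ennreal) \<Rightarrow> 'a \<Rightarrow> real" where
  "discounted_reward X \<alpha> g \<tau> \<omega> =
     (if \<tau> \<omega> = \<infinity> then 0 else exp (- \<alpha> * enn2real (\<tau> \<omega>)) * g (at_time X \<tau> \<omega>))"

(* For nonnegative g the expectation always exists in [0,\<infinity>]. *)
definition expected_reward ::
    "(real \<Rightarrow> 'a measure) \<Rightarrow> (real \<Rightarrow> 'a \<Rightarrow> real) \<Rightarrow> real \<Rightarrow> (real \<Rightarrow> real) \<Rightarrow> real \<Rightarrow>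
     ('a \<Rightarrow> ennreal) \<Rightarrow> ennreal" where
  "expected_reward P X \<alpha> g x \<tau> = (\<integral>\<^sup>+\<omega>. ennreal (discounted_reward X \<alpha> g \<tau> \<omega>) \<partial>P x)"

definition first_passage :: "(real \<Rightarrow> 'a \<Rightarrow> real) \<Rightarrow> real \<Rightarrow> 'a \<Rightarrow> ennreal" where
  "first_passage X b \<omega> = Inf (ennreal ` {t. 0 \<le> t \<and> X t \<omega> \<ge> b})"

end

theory Submission
  imports Defs
begin

text \<open>Let \<open>U \<phi> (x) = E_x (\<integral>_0^\<infinity> exp (- \<alpha> t) \<phi>(X_t) dt)\<close> denote the \<open>\<alpha>\<close>-potential of \<open>\<phi>\<close>, which is the integral of
  \<open>\<phi>\<close> against the Green kernel. The strong Markov property gives, for every stopping time \<open>\<tau>\<close> and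
  nonnegative \<open>\<phi>\<close>, the decomposition
  \<open>U \<phi> (x) = E_x (\<integral>_0^\<tau> exp (- \<alpha> t) \<phi>(X_t) dt) + E_x (exp (- \<alpha> \<tau>) U \<phi> (X_\<tau>))\<close>
  (\<open>potential_split_at_stopping_time\<close>), on which everything rests.

  The function \<open>V\<close> is the potential of \<open>\<phi> = f\<close> truncated to \<open>{x*..}\<close>, which is nonnegative, and \<open>g\<close> is the
  potential of \<open>f\<close> by the martingale property and the growth conditions (\<open>reward_eq_potential\<close>).
  Above \<open>x*\<close> the two coincide (\<open>truncated_potential_eq_above_level\<close>): before the process first falls below
  \<open>x*\<close> there is no difference between \<open>f\<close> and \<open>\<phi>\<close>, and in the absence of negative jumps the process is at \<open>x*\<close>
  at that time, where \<open>g\<close> and \<open>V\<close> agree by the equation for \<open>x*\<close>. So \<open>V \<ge> g\<close> everywhere, and the decomposition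
  shows that the expected reward of any stopping time is at most \<open>V\<close> (\<open>expected_reward_le_potential\<close>).
  For the first passage \<open>\<tau>*\<close> above \<open>x*\<close> the bound is attained (\<open>expected_reward_first_passage\<close>), because
  \<open>\<phi>(X_t) = 0\<close> before \<open>\<tau>*\<close> and \<open>V = g\<close> at \<open>X_\<tau>*\<close>. Finally \<open>\<tau>*\<close> is a stopping time by
  quasi-left-continuity and completeness (\<open>first_passage_stopping_time\<close>).\<close>

section \<open>Measurability from right continuity\<close>

text \<open>Approximate \<open>f t\<close> by \<open>f (d n t)\<close>, where \<open>d n t\<close> is the least multiple of \<open>1/(n+1)\<close>
  strictly greater than \<open>t\<close>. Each approximation takes countably many time values, and the
  right continuity hypothesis needs to be stated only for strictly later times.\<close>
lemma right_continuous_jointly_measurable: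
  fixes f :: "real \<Rightarrow> 'b \<Rightarrow> real"
  assumes [measurable]: "\<And>t. f t \<in> borel_measurable N"
    and right: "\<And>t b u. b \<in> space N \<Longrightarrow> (\<And>n. t < u n) \<Longrightarrow> u \<longlonglongrightarrow> t \<Longrightarrow> (\<lambda>n. f (u n) b) \<longlonglongrightarrow> f t b"
  shows "(\<lambda>(t, b). f t b) \<in> borel_measurable (borel \<Otimes>\<^sub>M N)"
proof -
  define d where "d n t = (of_int \<lfloor>real (Suc n) * t\<rfloor> + 1) / real (Suc n)" for n and t :: real
  have gt: "t < d n t" and le: "d n t \<le> t + 1 / real (Suc n)" for n t
  proof -
    have "real (Suc n) * t < of_int \<lfloor>real (Suc n) * t\<rfloor> + 1"
      "of_int \<lfloor>real (Suc n) * t\<rfloor> \<le> real (Suc n) * t" by linarith+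
    then show "t < d n t" "d n t \<le> t + 1 / real (Suc n)"
      unfolding d_def by (auto simp: field_simps simp del: of_nat_Suc)
  qed
  have lim: "(\<lambda>n. d n t) \<longlonglongrightarrow> t" for t
  proof (rule tendsto_sandwich[of "\<lambda>_. t" _ _ "\<lambda>n. t + 1 / real (Suc n)"])
    show "(\<lambda>n. t + 1 / real (Suc n)) \<longlonglongrightarrow> t"
      using tendsto_add[OF tendsto_const[of t] LIMSEQ_inverse_real_of_nat] by (simp add: inverse_eq_divide)
  qed (use less_imp_le[OF gt] le in simp_all)
  have meas: "(\<lambda>p. f (d n (fst p)) (snd p)) \<in> borel_measurable (borel \<Otimes>\<^sub>M N)" for n
  proof -
    have "(\<lambda>p. f ((of_int k + 1) / real (Suc n)) (snd p)) \<in> borel_measurable (borel \<Otimes>\<^sub>M N)" for k :: int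
      by measurable
    moreover have "(\<lambda>p. \<lfloor>real (Suc n) * fst p\<rfloor>) \<in> borel \<Otimes>\<^sub>M N \<rightarrow>\<^sub>M count_space UNIV"
      by measurable
    ultimately show ?thesis
      unfolding d_def by (rule measurable_compose_countable)
  qed
  show ?thesis
  proof (rule borel_measurable_LIMSEQ_real[OF _ meas])
    fix p :: "real \<times> 'b" assume "p \<in> space (borel \<Otimes>\<^sub>M N)"
    then have "snd p \<in> space N" by (auto simp: space_pair_measure)
    from right[OF this gt lim] show "(\<lambda>n. f (d n (fst p)) (snd p)) \<longlonglongrightarrow> (case p of (t, b) \<Rightarrow> f t b)"
      by (simp add: split_beta)
  qed
qed

text \<open>The strong Markov property gives the conditional probability of \<open>B\<close> only on the event that
  a stopping time is finite; this is why the identification with \<open>q\<close> is required only where the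
  weight \<open>w\<close> does not vanish.\<close>
lemma (in sigma_finite_subalgebra) nn_integral_mult_cond_exp_indicator:
  assumes "finite_measure M"
    and w[measurable]: "w \<in> borel_measurable F" and w_nonneg: "\<And>\<omega>. 0 \<le> w \<omega>" and w_le: "\<And>\<omega>. w \<omega> \<le> 1"
    and B[measurable]: "B \<in> sets M" and q[measurable]: "q \<in> borel_measurable M"
    and q_nonneg: "\<And>\<omega>. 0 \<le> q \<omega>"
    and eq: "AE \<omega> in M. w \<omega> \<noteq> 0 \<longrightarrow> real_cond_exp M F (indicator B) \<omega> = q \<omega>"
  shows "(\<integral>\<^sup>+\<omega>. ennreal (w \<omega>) * indicator B \<omega> \<partial>M) = (\<integral>\<^sup>+\<omega>. ennreal (w \<omega>) * ennreal (q \<omega>) \<partial>M)"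
proof -
  interpret finite_measure M by fact
  have [measurable]: "w \<in> borel_measurable M"
    by (rule measurable_from_subalg[OF subalg w])
  have int: "integrable M (\<lambda>\<omega>. w \<omega> * indicator B \<omega>)"
    by (rule integrable_const_bound[where B=1])
      (auto simp: w_le w_nonneg split: split_indicator)
  have ae: "AE \<omega> in M. w \<omega> * real_cond_exp M F (indicator B) \<omega> = w \<omega> * q \<omega>"
    using eq by eventually_elim auto
  have intq: "integrable M (\<lambda>\<omega>. w \<omega> * q \<omega>)"
    using real_cond_exp_intg(1)[OF int w] B
    by (subst integrable_cong_AE[OF _ _ ae, symmetric]) auto
  have "(\<integral>\<^sup>+\<omega>. ennreal (w \<omega>) * indicator B \<omega> \<partial>M) = (\<integral>\<^sup>+\<omega>. ennreal (w \<omega> * indicator B \<omega>) \<partial>M)"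
    by (intro nn_integral_cong) (auto split: split_indicator)
  also have "\<dots> = ennreal (\<integral>\<omega>. w \<omega> * indicator B \<omega> \<partial>M)"
    by (rule nn_integral_eq_integral[OF int]) (auto simp: w_nonneg)
  also have "(\<integral>\<omega>. w \<omega> * indicator B \<omega> \<partial>M) = (\<integral>\<omega>. w \<omega> * q \<omega> \<partial>M)"
    using real_cond_exp_intg(2)[OF int w] B integral_cong_AE[OF _ _ ae] by simp
  also have "ennreal \<dots> = (\<integral>\<^sup>+\<omega>. ennreal (w \<omega> * q \<omega>) \<partial>M)"
    by (rule nn_integral_eq_integral[OF intq, symmetric]) (auto simp: w_nonneg q_nonneg)
  also have "\<dots> = (\<integral>\<^sup>+\<omega>. ennreal (w \<omega>) * ennreal (q \<omega>) \<partial>M)"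
    by (simp add: ennreal_mult w_nonneg q_nonneg)
  finally show ?thesis .
qed

section \<open>Paths and transition kernels\<close>

context standard_markov_process
begin

declare sets_P[measurable_cong]

lemma space_P: "space (P x) = space M"
  by (rule sets_eq_imp_space_eq[OF sets_P])

lemma space_F: "0 \<le> t \<Longrightarrow> space (F t) = space M"
  using subalgebra_F[of t] by (simp add: subalgebra_def)

lemma sets_F_subset: "0 \<le> t \<Longrightarrow> sets (F t) \<subseteq> sets M"
  using subalgebra_F[of t] by (simp add: subalgebra_def)

lemma X_adapted:
  assumes "0 \<le> t" shows "X t \<in> borel_measurable (F t)"
proof -
  have "(\<lambda>\<omega>. (t, \<omega>)) \<in> F t \<rightarrow>\<^sub>M restrict_space borel {0..t} \<Otimes>\<^sub>M F t"
    using assms by (intro measurable_Pair) (auto simp: space_restrict_space)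
  from measurable_compose[OF this progressive[OF assms]] show ?thesis by simp
qed

lemma X_measurable: "0 \<le> t \<Longrightarrow> X t \<in> borel_measurable M"
  using measurable_from_subalg[OF subalgebra_F X_adapted] .

text \<open>The process extended by \<open>X 0\<close> to negative times. The extension is right-continuous on the whole
  real line, so that no side condition on the sign of the time is needed for measurability.\<close>
definition path :: "real \<Rightarrow> 'a \<Rightarrow> real" where
  "path t = X (max 0 t)"

lemma path_eq: "0 \<le> t \<Longrightarrow> path t = X t"
  by (simp add: path_def max_def)

lemma path_measurable [measurable]: "path t \<in> borel_measurable M"
  by (simp add: path_def X_measurable)

lemma path_right_continuous:
  assumes "\<omega> \<in> space M"
  shows "((\<lambda>s. path s \<omega>) \<longlongrightarrow> path t \<omega>) (at_right t)"
proof (cases "0 \<le> t")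
  case True
  have "\<forall>\<^sub>F s in at_right t. path s \<omega> = X s \<omega>"
    using eventually_at_right_less[of t] by eventually_elim (use True in \<open>simp add: path_eq\<close>)
  then show ?thesis
    using right_continuous_paths[OF assms True] True
    by (simp add: path_eq tendsto_cong)
next
  case False
  then have "\<forall>\<^sub>F s in at_right t. path s \<omega> = path t \<omega>"
    unfolding eventually_at_right_field by (intro exI[of _ 0]) (auto simp: path_def max_def)
  then show ?thesis by (simp add: tendsto_eventually)
qed

lemma path_right_continuous_seq:
  assumes "\<omega> \<in> space M" "\<And>n. t < u n" "u \<longlonglongrightarrow> t"
  shows "(\<lambda>n. path (u n) \<omega>) \<longlonglongrightarrow> path t \<omega>"
proof (rule filterlim_compose[OF path_right_continuous[OF assms(1)]])
  show "filterlim u (at_right t) sequentially"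
    unfolding filterlim_at using assms(2,3) by (auto simp: less_imp_neq[symmetric])
qed

lemma path_jointly_measurable:
  "(\<lambda>(t, \<omega>). path t \<omega>) \<in> borel_measurable (borel \<Otimes>\<^sub>M M)"
  by (rule right_continuous_jointly_measurable) (auto intro: path_right_continuous_seq)

lemma path_measurable_compose [measurable (raw)]:
  assumes [measurable]: "\<theta> \<in> borel_measurable N" "h \<in> N \<rightarrow>\<^sub>M M"
  shows "(\<lambda>z. path (\<theta> z) (h z)) \<in> borel_measurable N"
proof -
  have "(\<lambda>z. (\<theta> z, h z)) \<in> N \<rightarrow>\<^sub>M borel \<Otimes>\<^sub>M M" by measurable
  from measurable_compose[OF this path_jointly_measurable] show ?thesis by simp
qed

text \<open>The law of \<open>X t\<close> under \<open>P x\<close>, as a measure on the state space; for negative \<open>t\<close>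
  it is the law of \<open>X 0\<close>.\<close>
definition trans :: "real \<Rightarrow> real \<Rightarrow> real measure" where
  "trans t x = distr (P x) borel (path t)"

lemma prob_space_trans: "prob_space (trans t x)"
proof -
  interpret prob_space "P x" by (rule prob_space_P)
  show ?thesis unfolding trans_def by (rule prob_space_distr) measurable
qed

lemma sets_trans [simp, measurable_cong]: "sets (trans t x) = sets borel"
  by (simp add: trans_def)

lemma measure_trans:
  assumes "0 \<le> t" "H \<in> sets borel"
  shows "measure (trans t x) H = transition_prob P X t x H"
proof -
  have "path t -` H \<inter> space (P x) = {\<omega> \<in> space (P x). X t \<omega> \<in> H}"
    using assms(1) by (auto simp: path_eq)
  moreover have "measure (trans t x) H = measure (P x) (path t -` H \<inter> space (P x))"
    unfolding trans_def using assms(2) by (intro measure_distr) auto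
  ultimately show ?thesis by (simp add: transition_prob_def)
qed

lemma emeasure_trans:
  assumes "0 \<le> t" "H \<in> sets borel"
  shows "emeasure (trans t x) H = ennreal (transition_prob P X t x H)"
proof -
  interpret prob_space "trans t x" by (rule prob_space_trans)
  show ?thesis by (simp add: emeasure_eq_measure measure_trans assms)
qed

lemma trans_measurable1: "trans t \<in> borel \<rightarrow>\<^sub>M subprob_algebra borel"
proof (rule measurable_subprob_algebra)
  have t: "trans t x = trans (max 0 t) x" for x by (simp add: trans_def path_def)
  fix A :: "real set" assume "A \<in> sets borel"
  then show "(\<lambda>x. emeasure (trans t x) A) \<in> borel_measurable borel"
    unfolding t by (simp add: emeasure_trans measurable_compose[OF borel_transition measurable_ennreal])
qed (auto intro: prob_space_imp_subprob_space prob_space_trans)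

text \<open>Joint measurability in time and space. For a bounded continuous \<open>r\<close>, the map
  \<open>t \<mapsto> E_x r(X_t)\<close> is right-continuous, so that \<open>E_x r(X_t)\<close> is jointly measurable; the indicators of
  the half-lines \<open>{a<..}\<close>, which generate the Borel sets, are limits of such \<open>r\<close>.\<close>
lemma trans_measurable2:
  "(\<lambda>(t, x). trans t x) \<in> borel \<Otimes>\<^sub>M borel \<rightarrow>\<^sub>M subprob_algebra borel"
proof (rule measurable_subprob_algebra_generated[where \<Omega>=UNIV and G="range greaterThan"])
  show "sets borel = sigma_sets UNIV (range greaterThan :: real set set)"
    by (subst borel_Ioi) simp
  show "Int_stable (range greaterThan :: real set set)"
    unfolding Int_stable_def
  proof safe
    fix a b :: real
    have "{a<..} \<inter> {b<..} = {max a b<..}" by auto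
    then show "{a<..} \<inter> {b<..} \<in> range greaterThan" by blast
  qed
  fix A :: "real set" assume "A \<in> range greaterThan"
  then obtain a where A: "A = {a<..}" by auto
  define r :: "nat \<Rightarrow> real \<Rightarrow> real" where "r n y = min 1 (max 0 (real n * (y - a)))" for n y
  have r_cont: "isCont (r n) y" for n y
    unfolding r_def by (intro continuous_intros)
  have r_bound: "norm (r n y) \<le> 1" for n y by (auto simp: r_def)
  have r_meas [measurable]: "r n \<in> borel_measurable borel" for n
    unfolding r_def by measurable
  have r_lim: "(\<lambda>n. r n y) \<longlonglongrightarrow> indicator A y" for y
  proof (cases "a < y")
    case True
    then obtain N where N: "1 / (y - a) \<le> real N" using real_arch_simple by blast
    have "\<forall>\<^sub>F n in sequentially. r n y = 1"
    proof (rule eventually_sequentiallyI)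
      fix n assume "N \<le> n"
      with N have "1 / (y - a) \<le> real n" by linarith
      with True have "1 \<le> real n * (y - a)" by (simp add: field_simps)
      then show "r n y = 1" by (simp add: r_def)
    qed
    then show ?thesis using True A by (simp add: tendsto_eventually)
  next
    case False
    then have "real n * (y - a) \<le> 0" for n by (simp add: mult_le_0_iff)
    then have "r n y = 0" for n by (simp add: r_def)
    then show ?thesis using False A by simp
  qed
  have int: "(\<lambda>(t, x). \<integral>\<omega>. r n (path t \<omega>) \<partial>P x) \<in> borel_measurable (borel \<Otimes>\<^sub>M borel)" for n
  proof (rule right_continuous_jointly_measurable)
    fix t
    have "(\<lambda>x. \<integral>\<omega>. r n (path t \<omega>) \<partial>P x) = (\<lambda>x. \<integral>y. r n y \<partial>trans t x)"
      unfolding trans_def by (intro ext integral_distr[symmetric]) measurable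
    also have "\<dots> = (\<lambda>x. enn2real (\<integral>\<^sup>+y. r n y \<partial>trans t x))"
      by (intro ext integral_eq_nn_integral) (auto simp: r_def)
    also have "\<dots> \<in> borel_measurable borel"
      using measurable_compose[OF trans_measurable1 nn_integral_measurable_subprob_algebra[of "\<lambda>y. ennreal (r n y)" borel]]
      by measurable
    finally show "(\<lambda>x. \<integral>\<omega>. r n (path t \<omega>) \<partial>P x) \<in> borel_measurable borel" .
  next
    fix t x and u :: "nat \<Rightarrow> real" assume u: "\<And>n. t < u n" "u \<longlonglongrightarrow> t"
    interpret prob_space "P x" by (rule prob_space_P)
    show "(\<lambda>k. \<integral>\<omega>. r n (path (u k) \<omega>) \<partial>P x) \<longlonglongrightarrow> (\<integral>\<omega>. r n (path t \<omega>) \<partial>P x)"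
    proof (rule integral_dominated_convergence[where w="\<lambda>_. 1"])
      show "AE \<omega> in P x. (\<lambda>k. r n (path (u k) \<omega>)) \<longlonglongrightarrow> r n (path t \<omega>)"
        by (auto intro!: AE_I2 isCont_tendsto_compose[OF r_cont] path_right_continuous_seq u simp: space_P)
    qed (use r_bound in simp_all)
  qed
  have "(\<lambda>(t, x). measure (trans t x) A) \<in> borel_measurable (borel \<Otimes>\<^sub>M borel)"
  proof (rule borel_measurable_LIMSEQ_real[OF _ int])
    fix p :: "real \<times> real"
    obtain t x where p: "p = (t, x)" by (cases p)
    interpret T: prob_space "trans t x" by (rule prob_space_trans)
    have "(\<lambda>n. \<integral>y. r n y \<partial>trans t x) \<longlonglongrightarrow> (\<integral>y. indicator A y \<partial>trans t x)"
      by (rule integral_dominated_convergence[where w="\<lambda>_. 1"]) (use r_bound r_lim A in simp_all)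
    moreover have "(\<integral>y. r n y \<partial>trans t x) = (\<integral>\<omega>. r n (path t \<omega>) \<partial>P x)" for n
      unfolding trans_def by (rule integral_distr) measurable
    ultimately show "(\<lambda>n. case p of (t, x) \<Rightarrow> \<integral>\<omega>. r n (path t \<omega>) \<partial>P x) \<longlonglongrightarrow> (case p of (t, x) \<Rightarrow> measure (trans t x) A)"
      by (simp add: p A)
  qed
  then have "(\<lambda>p. ennreal (measure (trans (fst p) (snd p)) A)) \<in> borel_measurable (borel \<Otimes>\<^sub>M borel)"
    by (simp add: split_beta)
  moreover have "emeasure (trans t x) A = ennreal (measure (trans t x) A)" for t x
  proof -
    interpret T: prob_space "trans t x" by (rule prob_space_trans)
    show ?thesis by (rule T.emeasure_eq_measure)
  qed
  ultimately show "(\<lambda>p. emeasure (case p of (t, x) \<Rightarrow> trans t x) A) \<in> borel_measurable (borel \<Otimes>\<^sub>M borel)"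
    by (simp add: split_beta)
next
  have "emeasure (trans t x) UNIV = 1" for t x
    using prob_space.emeasure_space_1[OF prob_space_trans[of t x]] by (simp add: trans_def)
  then show "(\<lambda>p. emeasure (case p of (t, x) \<Rightarrow> trans t x) UNIV) \<in> borel_measurable (borel \<Otimes>\<^sub>M borel)"
    by (simp add: split_beta)
qed (auto intro: prob_space_imp_subprob_space prob_space_trans)

lemma nn_integral_trans_measurable [measurable (raw)]:
  assumes [measurable]: "\<phi> \<in> borel_measurable borel" "a \<in> borel_measurable N" "b \<in> borel_measurable N"
  shows "(\<lambda>z. \<integral>\<^sup>+y. (\<phi> y :: ennreal) \<partial>trans (a z) (b z)) \<in> borel_measurable N"
proof -
  have "(\<lambda>z. (a z, b z)) \<in> N \<rightarrow>\<^sub>M borel \<Otimes>\<^sub>M borel" by measurable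
  from measurable_compose[OF measurable_compose[OF this trans_measurable2]
      nn_integral_measurable_subprob_algebra[of \<phi> borel]]
  show ?thesis by simp
qed

section \<open>The strong Markov property at discounted stopping times\<close>

lemma stopping_time_less_in_F:
  assumes "is_stopping_time F \<tau>" "0 \<le> t"
  shows "{\<omega> \<in> space M. \<tau> \<omega> < ennreal t} \<in> sets (F t)"
  using assms unfolding is_stopping_time_def by (auto simp: space_F)

lemma stopping_time_less_in_M:
  assumes "is_stopping_time F \<tau>"
  shows "{\<omega> \<in> space M. \<tau> \<omega> < y} \<in> sets M"
proof (cases y rule: ennreal_cases)
  case (real r)
  then show ?thesis
    using stopping_time_less_in_F[OF assms real(1)] sets_F_subset[OF real(1)] by auto
next
  case top
  have "{\<omega> \<in> space M. \<tau> \<omega> < y} = (\<Union>n. {\<omega> \<in> space M. \<tau> \<omega> < ennreal (real n)})"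
  proof safe
    fix \<omega> assume "\<tau> \<omega> < y"
    then obtain r where "0 \<le> r" "\<tau> \<omega> = ennreal r" by (cases "\<tau> \<omega>" rule: ennreal_cases) (auto simp: top)
    moreover obtain n where "r < real n" using reals_Archimedean2 by blast
    ultimately show "\<omega> \<in> (\<Union>n. {\<omega> \<in> space M. \<tau> \<omega> < ennreal (real n)})" if "\<omega> \<in> space M"
      using that by (auto simp: ennreal_less_iff intro!: exI[of _ n])
  qed (simp_all add: top order_less_trans[OF _ ennreal_less_top])
  also have "\<dots> \<in> sets M"
    by (intro sets.countable_nat_UN) (use stopping_time_less_in_F[OF assms] sets_F_subset of_nat_0_le_iff in blast)
  finally show ?thesis .
qed

lemma space_stopped_algebra [simp]: "space (stopped_algebra M F \<tau>) = space M"
  unfolding stopped_algebra_def by (rule space_measure_of) (auto dest: sets.sets_into_space)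

lemma sets_stopped_algebra:
  "sets (stopped_algebra M F \<tau>) =
    sigma_sets (space M) {A \<in> sets M. \<forall>t\<ge>0. {\<omega> \<in> A. \<tau> \<omega> < ennreal t} \<in> sets (F t)}"
  unfolding stopped_algebra_def by (rule sets_measure_of) (auto dest: sets.sets_into_space)

lemma subalgebra_stopped_algebra: "subalgebra (P x) (stopped_algebra M F \<tau>)"
  unfolding subalgebra_def sets_stopped_algebra sets_P
  by (auto simp: space_P intro!: sets.sigma_sets_subset)

lemma stopping_time_measurable_stopped:
  assumes "is_stopping_time F \<tau>"
  shows "\<tau> \<in> borel_measurable (stopped_algebra M F \<tau>)"
proof (rule borel_measurableI_less)
  fix y
  have "{\<omega> \<in> {\<omega> \<in> space M. \<tau> \<omega> < y}. \<tau> \<omega> < ennreal t} \<in> sets (F t)" if t: "0 \<le> t" for t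
  proof (cases "y \<le> ennreal t")
    case True
    then obtain r where r: "0 \<le> r" "y = ennreal r"
      by (cases y rule: ennreal_cases) (auto simp: top_unique)
    with True t have "r \<le> t" by simp
    have "{\<omega> \<in> {\<omega> \<in> space M. \<tau> \<omega> < y}. \<tau> \<omega> < ennreal t} = {\<omega> \<in> space M. \<tau> \<omega> < ennreal r}"
      using True r by auto
    then show ?thesis
      using stopping_time_less_in_F[OF assms r(1)] mono_F[OF r(1) \<open>r \<le> t\<close>] by auto
  next
    case False
    then have "{\<omega> \<in> {\<omega> \<in> space M. \<tau> \<omega> < y}. \<tau> \<omega> < ennreal t} = {\<omega> \<in> space M. \<tau> \<omega> < ennreal t}"
      by auto
    then show ?thesis using stopping_time_less_in_F[OF assms t] by simp
  qed
  then show "{\<omega> \<in> space (stopped_algebra M F \<tau>). \<tau> \<omega> < y} \<in> sets (stopped_algebra M F \<tau>)"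
    unfolding sets_stopped_algebra space_stopped_algebra
    using stopping_time_less_in_M[OF assms, of y] by (intro sigma_sets.Basic) simp
qed

lemma stopping_time_measurable:
  assumes "is_stopping_time F \<tau>"
  shows "\<tau> \<in> borel_measurable M"
  by (rule borel_measurableI_less) (rule stopping_time_less_in_M[OF assms])

lemma sigma_finite_subalgebra_P:
  assumes "subalgebra (P x) G"
  shows "sigma_finite_subalgebra (P x) G"
proof -
  interpret prob_space "P x" by (rule prob_space_P)
  interpret finite_measure_subalgebra "P x" G by unfold_locales (rule assms)
  show ?thesis by unfold_locales
qed

text \<open>The discount factor \<open>exp (- \<alpha> u)\<close> at a random time, with the value 0 at \<open>\<infinity>\<close>; it thus also carries
  the restriction to the event that the time is finite.\<close>
definition disc :: "real \<Rightarrow> ennreal \<Rightarrow> ennreal" where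
  "disc \<alpha> u = (if u = \<infinity> then 0 else ennreal (exp (- \<alpha> * enn2real u)))"

lemma disc_measurable [measurable]: "disc \<alpha> \<in> borel_measurable borel"
  unfolding disc_def by measurable

lemma at_time_eq_path: "at_time X \<tau> \<omega> = path (enn2real (\<tau> \<omega>)) \<omega>"
  by (simp add: at_time_def path_eq)

lemma at_time_measurable [measurable (raw)]:
  assumes [measurable]: "\<tau> \<in> borel_measurable M"
  shows "at_time X \<tau> \<in> borel_measurable M"
proof -
  have "(\<lambda>\<omega>. path (enn2real (\<tau> \<omega>)) \<omega>) \<in> borel_measurable M" by measurable
  then show ?thesis unfolding at_time_eq_path[abs_def] .
qed

lemma strong_markov_indicator:
  assumes \<alpha>: "0 < \<alpha>" and \<tau>: "is_stopping_time F \<tau>" and t: "0 \<le> t" and H: "H \<in> sets borel"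
  shows "(\<integral>\<^sup>+\<omega>. disc \<alpha> (\<tau> \<omega>) * indicator H (path (enn2real (\<tau> \<omega>) + t) \<omega>) \<partial>P x)
       = (\<integral>\<^sup>+\<omega>. disc \<alpha> (\<tau> \<omega>) * emeasure (trans t (at_time X \<tau> \<omega>)) H \<partial>P x)"
proof -
  note [measurable] = stopping_time_measurable[OF \<tau>] H
  interpret prob_space "P x" by (rule prob_space_P)
  interpret sigma_finite_subalgebra "P x" "stopped_algebra M F \<tau>"
    by (rule sigma_finite_subalgebra_P[OF subalgebra_stopped_algebra])
  define w where "w \<omega> = (if \<tau> \<omega> = \<infinity> then 0 else exp (- \<alpha> * enn2real (\<tau> \<omega>)))" for \<omega>
  define B where "B = {\<omega> \<in> space M. \<tau> \<omega> < \<infinity> \<and> at_time X (\<lambda>\<omega>. \<tau> \<omega> + ennreal t) \<omega> \<in> H}"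
  define q where "q \<omega> = transition_prob P X t (at_time X \<tau> \<omega>) H" for \<omega>
  have disc_w: "disc \<alpha> (\<tau> \<omega>) = ennreal (w \<omega>)" for \<omega>
    by (simp add: disc_def w_def)
  have shift: "at_time X (\<lambda>\<omega>. \<tau> \<omega> + ennreal t) \<omega> = path (enn2real (\<tau> \<omega>) + t) \<omega>" if "\<tau> \<omega> \<noteq> \<infinity>" for \<omega>
    using that t by (simp add: at_time_eq_path enn2real_plus less_top)
  have q_meas: "q \<in> borel_measurable (P x)"
    unfolding q_def using measurable_compose[OF at_time_measurable borel_transition[OF t H]] by measurable
  have B_meas: "B \<in> sets (P x)"
    unfolding B_def at_time_eq_path by measurable
  have w_meas: "w \<in> borel_measurable (stopped_algebra M F \<tau>)"
  proof -
    note [measurable] = stopping_time_measurable_stopped[OF \<tau>]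
    show ?thesis unfolding w_def by measurable
  qed
  have "(\<integral>\<^sup>+\<omega>. disc \<alpha> (\<tau> \<omega>) * indicator H (path (enn2real (\<tau> \<omega>) + t) \<omega>) \<partial>P x)
      = (\<integral>\<^sup>+\<omega>. ennreal (w \<omega>) * indicator B \<omega> \<partial>P x)"
    by (intro nn_integral_cong)
      (auto simp: disc_w w_def B_def shift space_P less_top split: split_indicator)
  also have "\<dots> = (\<integral>\<^sup>+\<omega>. ennreal (w \<omega>) * ennreal (q \<omega>) \<partial>P x)"
  proof (rule nn_integral_mult_cond_exp_indicator[OF _ w_meas _ _ B_meas q_meas])
    show "AE \<omega> in P x. w \<omega> \<noteq> 0 \<longrightarrow> real_cond_exp (P x) (stopped_algebra M F \<tau>) (indicator B) \<omega> = q \<omega>"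
      using strong_markov[OF \<tau> t H, of x] unfolding B_def[symmetric] q_def[symmetric]
      by eventually_elim (auto simp: w_def less_top)
    show "w \<omega> \<le> 1" for \<omega> using \<alpha> by (auto simp: w_def)
  qed (auto simp: w_def q_def transition_prob_def intro: finite_measure_axioms)
  also have "\<dots> = (\<integral>\<^sup>+\<omega>. disc \<alpha> (\<tau> \<omega>) * emeasure (trans t (at_time X \<tau> \<omega>)) H \<partial>P x)"
    by (simp add: disc_w q_def emeasure_trans t H)
  finally show ?thesis .
qed

text \<open>Both sides are integrals of \<open>\<phi>\<close> with respect to measures on the state space: the image of the
  law weighted by the discount factor, and the same weighted law followed by the transition kernel.
  These measures agree by the case of indicators.\<close>
lemma strong_markov_nn_integral:
  assumes \<alpha>: "0 < \<alpha>" and \<tau>: "is_stopping_time F \<tau>" and t: "0 \<le> t"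
    and \<phi>[measurable]: "\<phi> \<in> borel_measurable borel"
  shows "(\<integral>\<^sup>+\<omega>. disc \<alpha> (\<tau> \<omega>) * \<phi> (path (enn2real (\<tau> \<omega>) + t) \<omega>) \<partial>P x)
       = (\<integral>\<^sup>+\<omega>. disc \<alpha> (\<tau> \<omega>) * (\<integral>\<^sup>+y. \<phi> y \<partial>trans t (at_time X \<tau> \<omega>)) \<partial>P x)"
proof -
  note [measurable] = stopping_time_measurable[OF \<tau>] at_time_measurable
  define D where "D = density (P x) (\<lambda>\<omega>. disc \<alpha> (\<tau> \<omega>))"
  have [measurable_cong]: "sets D = sets M" by (simp add: D_def sets_P)
  have D_nn: "(\<integral>\<^sup>+\<omega>. u \<omega> \<partial>D) = (\<integral>\<^sup>+\<omega>. disc \<alpha> (\<tau> \<omega>) * u \<omega> \<partial>P x)"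
    if [measurable]: "u \<in> borel_measurable M" for u
    unfolding D_def by (rule nn_integral_density) measurable
  have K: "(\<lambda>\<omega>. trans t (at_time X \<tau> \<omega>)) \<in> D \<rightarrow>\<^sub>M subprob_algebra borel"
    by (rule measurable_compose[OF _ trans_measurable1]) measurable
  have nonempty: "space D \<noteq> {}"
    using prob_space.not_empty[OF prob_space_P[of x]] by (simp add: D_def)
  have "distr D borel (\<lambda>\<omega>. path (enn2real (\<tau> \<omega>) + t) \<omega>) = D \<bind> (\<lambda>\<omega>. trans t (at_time X \<tau> \<omega>))"
  proof (rule measure_eqI)
    show "sets (distr D borel (\<lambda>\<omega>. path (enn2real (\<tau> \<omega>) + t) \<omega>)) = sets (D \<bind> (\<lambda>\<omega>. trans t (at_time X \<tau> \<omega>)))"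
      by (simp add: sets_bind[where N=borel] nonempty)
    fix H assume "H \<in> sets (distr D borel (\<lambda>\<omega>. path (enn2real (\<tau> \<omega>) + t) \<omega>))"
    then have H[measurable]: "H \<in> sets borel" by simp
    have "emeasure (distr D borel (\<lambda>\<omega>. path (enn2real (\<tau> \<omega>) + t) \<omega>)) H
        = (\<integral>\<^sup>+\<omega>. indicator H (path (enn2real (\<tau> \<omega>) + t) \<omega>) \<partial>D)"
      using nn_integral_distr[of "\<lambda>\<omega>. path (enn2real (\<tau> \<omega>) + t) \<omega>" D borel "indicator H"] by simp
    also have "\<dots> = (\<integral>\<^sup>+\<omega>. emeasure (trans t (at_time X \<tau> \<omega>)) H \<partial>D)"
      using measurable_compose[OF K[unfolded measurable_cong_sets[OF \<open>sets D = sets M\<close> refl]]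
          measurable_emeasure_subprob_algebra[OF H]]
      by (simp add: D_nn strong_markov_indicator[OF \<alpha> \<tau> t H])
    also have "\<dots> = emeasure (D \<bind> (\<lambda>\<omega>. trans t (at_time X \<tau> \<omega>))) H"
      by (rule emeasure_bind[OF nonempty K H, symmetric])
    finally show "emeasure (distr D borel (\<lambda>\<omega>. path (enn2real (\<tau> \<omega>) + t) \<omega>)) H = \<dots>" .
  qed
  then have "(\<integral>\<^sup>+y. \<phi> y \<partial>distr D borel (\<lambda>\<omega>. path (enn2real (\<tau> \<omega>) + t) \<omega>))
      = (\<integral>\<^sup>+y. \<phi> y \<partial>(D \<bind> (\<lambda>\<omega>. trans t (at_time X \<tau> \<omega>))))" by simp
  then show ?thesis
    by (simp add: nn_integral_distr nn_integral_bind[OF \<phi> K] D_nn)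
qed

section \<open>Potentials\<close>

text \<open>The discounted integrand \<open>exp (- \<alpha> t) \<phi>(X_t)\<close>, cut off at negative times.\<close>
definition discounted :: "real \<Rightarrow> (real \<Rightarrow> ennreal) \<Rightarrow> real \<Rightarrow> 'a \<Rightarrow> ennreal" where
  "discounted \<alpha> \<phi> t \<omega> = ennreal (exp (- \<alpha> * t)) * \<phi> (path t \<omega>) * indicator {0..} t"

lemma discounted_measurable [measurable (raw)]:
  assumes [measurable]: "\<phi> \<in> borel_measurable borel" "a \<in> borel_measurable N" "b \<in> N \<rightarrow>\<^sub>M M"
  shows "(\<lambda>z. discounted \<alpha> \<phi> (a z) (b z)) \<in> borel_measurable N"
  unfolding discounted_def by measurable

text \<open>The \<open>\<alpha>\<close>-potential \<open>E_x (\<integral>_0^\<infinity> exp (- \<alpha> t) \<phi>(X_t) dt)\<close> of a nonnegative function, that is, the integral of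
  \<open>\<phi>\<close> against the \<open>\<alpha>\<close>-Green kernel (lemma \<open>nn_integral_green_kernel\<close>).\<close>
definition potential :: "real \<Rightarrow> (real \<Rightarrow> ennreal) \<Rightarrow> real \<Rightarrow> ennreal" where
  "potential \<alpha> \<phi> x = (\<integral>\<^sup>+t. (\<integral>\<^sup>+\<omega>. discounted \<alpha> \<phi> t \<omega> \<partial>P x) \<partial>lborel)"

lemma pair_sigma_finite_lborel_P: "pair_sigma_finite lborel (P x)"
proof -
  interpret prob_space "P x" by (rule prob_space_P)
  show ?thesis by unfold_locales
qed

lemma Fubini_P:
  assumes [measurable]: "(\<lambda>(t, \<omega>). h t \<omega>) \<in> borel_measurable (borel \<Otimes>\<^sub>M M)"
  shows "(\<integral>\<^sup>+t. (\<integral>\<^sup>+\<omega>. h t \<omega> \<partial>P x) \<partial>lborel) = (\<integral>\<^sup>+\<omega>. (\<integral>\<^sup>+t. (h t \<omega> :: ennreal) \<partial>lborel) \<partial>P x)"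
proof -
  interpret pair_sigma_finite lborel "P x" by (rule pair_sigma_finite_lborel_P)
  show ?thesis by (rule Fubini'[symmetric]) measurable
qed

lemma potential_eq:
  assumes [measurable]: "\<phi> \<in> borel_measurable borel"
  shows "potential \<alpha> \<phi> x = (\<integral>\<^sup>+\<omega>. (\<integral>\<^sup>+t. discounted \<alpha> \<phi> t \<omega> \<partial>lborel) \<partial>P x)"
  unfolding potential_def by (rule Fubini_P) measurable

lemma potential_trans:
  assumes [measurable]: "\<phi> \<in> borel_measurable borel"
  shows "potential \<alpha> \<phi> x =
    (\<integral>\<^sup>+t. ennreal (exp (- \<alpha> * t)) * indicator {0..} t * (\<integral>\<^sup>+y. \<phi> y \<partial>trans t x) \<partial>lborel)"
proof -
  have "(\<integral>\<^sup>+\<omega>. discounted \<alpha> \<phi> t \<omega> \<partial>P x) = ennreal (exp (- \<alpha> * t)) * indicator {0..} t * (\<integral>\<^sup>+y. \<phi> y \<partial>trans t x)" for t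
    unfolding discounted_def trans_def
    by (subst nn_integral_distr) (auto simp: mult_ac nn_integral_cmult[symmetric])
  then show ?thesis unfolding potential_def by simp
qed

lemma potential_measurable [measurable]:
  assumes [measurable]: "\<phi> \<in> borel_measurable borel"
  shows "potential \<alpha> \<phi> \<in> borel_measurable borel"
  unfolding potential_trans[OF assms, abs_def] by measurable

text \<open>The substitution \<open>t \<mapsto> u + t\<close>: what is accumulated from the random time \<open>u\<close> on. For \<open>u = \<infinity>\<close> both
  sides vanish.\<close>
lemma shifted_discounted_integral:
  assumes [measurable]: "\<phi> \<in> borel_measurable borel" and \<omega>: "\<omega> \<in> space M"
  shows "(\<integral>\<^sup>+t. ennreal (exp (- \<alpha> * t)) * indicator {0..} t * (disc \<alpha> u * \<phi> (path (enn2real u + t) \<omega>)) \<partial>lborel)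
    = (\<integral>\<^sup>+t. discounted \<alpha> \<phi> t \<omega> * indicator {u..} (ennreal t) \<partial>lborel)"
proof (cases u rule: ennreal_cases)
  case (real r)
  have [measurable]: "(\<lambda>t. path t \<omega>) \<in> borel_measurable borel"
    by (rule path_measurable_compose) (use \<omega> in auto)
  have "(\<integral>\<^sup>+t. discounted \<alpha> \<phi> t \<omega> * indicator {u..} (ennreal t) \<partial>lborel)
      = (\<integral>\<^sup>+t. ennreal (exp (- \<alpha> * t)) * \<phi> (path t \<omega>) * indicator {r..} t \<partial>lborel)"
    using real by (intro nn_integral_cong) (auto simp: discounted_def ennreal_le_iff2 split: split_indicator)
  also have "\<dots> = (\<integral>\<^sup>+t. ennreal (exp (- \<alpha> * (r + t))) * \<phi> (path (r + t) \<omega>) * indicator {r..} (r + t) \<partial>lborel)"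
    by (subst nn_integral_real_affine[where c=1 and t=r]) auto
  also have "\<dots> = (\<integral>\<^sup>+t. ennreal (exp (- \<alpha> * t)) * indicator {0..} t * (disc \<alpha> u * \<phi> (path (enn2real u + t) \<omega>)) \<partial>lborel)"
  proof (rule nn_integral_cong)
    fix t
    have "exp (- \<alpha> * (r + t)) = exp (- \<alpha> * t) * exp (- \<alpha> * r)"
      by (simp add: exp_add[symmetric] algebra_simps)
    then have "ennreal (exp (- \<alpha> * (r + t))) = ennreal (exp (- \<alpha> * t)) * disc \<alpha> u"
      using real by (simp add: ennreal_mult disc_def)
    then show "ennreal (exp (- \<alpha> * (r + t))) * \<phi> (path (r + t) \<omega>) * indicator {r..} (r + t)
      = ennreal (exp (- \<alpha> * t)) * indicator {0..} t * (disc \<alpha> u * \<phi> (path (enn2real u + t) \<omega>))"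
      using real by (auto simp: mult_ac split: split_indicator)
  qed
  finally show ?thesis ..
next
  case top
  have "(\<integral>\<^sup>+t. discounted \<alpha> \<phi> t \<omega> * indicator {u..} (ennreal t) \<partial>lborel) = (\<integral>\<^sup>+(t::real). 0 \<partial>lborel)"
    by (intro nn_integral_cong) (simp add: top top_unique)
  then show ?thesis by (simp add: top disc_def)
qed

lemma potential_at_stopping_time:
  assumes \<alpha>: "0 < \<alpha>" and \<tau>: "is_stopping_time F \<tau>" and [measurable]: "\<phi> \<in> borel_measurable borel"
  shows "(\<integral>\<^sup>+\<omega>. disc \<alpha> (\<tau> \<omega>) * potential \<alpha> \<phi> (at_time X \<tau> \<omega>) \<partial>P x)
    = (\<integral>\<^sup>+\<omega>. (\<integral>\<^sup>+t. discounted \<alpha> \<phi> t \<omega> * indicator {\<tau> \<omega>..} (ennreal t) \<partial>lborel) \<partial>P x)"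
proof -
  note [measurable] = stopping_time_measurable[OF \<tau>] at_time_measurable
  let ?e = "\<lambda>t. ennreal (exp (- \<alpha> * t)) * indicator {0..} t"
  have "(\<integral>\<^sup>+\<omega>. disc \<alpha> (\<tau> \<omega>) * potential \<alpha> \<phi> (at_time X \<tau> \<omega>) \<partial>P x)
    = (\<integral>\<^sup>+\<omega>. (\<integral>\<^sup>+t. ?e t * (disc \<alpha> (\<tau> \<omega>) * (\<integral>\<^sup>+y. \<phi> y \<partial>trans t (at_time X \<tau> \<omega>))) \<partial>lborel) \<partial>P x)"
    unfolding potential_trans[OF assms(3)]
    by (intro nn_integral_cong, subst nn_integral_cmult[symmetric]) (auto simp: mult_ac)
  also have "\<dots> = (\<integral>\<^sup>+t. (\<integral>\<^sup>+\<omega>. ?e t * (disc \<alpha> (\<tau> \<omega>) * (\<integral>\<^sup>+y. \<phi> y \<partial>trans t (at_time X \<tau> \<omega>))) \<partial>P x) \<partial>lborel)"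
    by (rule Fubini_P[symmetric]) measurable
  also have "\<dots> = (\<integral>\<^sup>+t. (\<integral>\<^sup>+\<omega>. ?e t * (disc \<alpha> (\<tau> \<omega>) * \<phi> (path (enn2real (\<tau> \<omega>) + t) \<omega>)) \<partial>P x) \<partial>lborel)"
  proof (rule nn_integral_cong)
    fix t
    show "(\<integral>\<^sup>+\<omega>. ?e t * (disc \<alpha> (\<tau> \<omega>) * (\<integral>\<^sup>+y. \<phi> y \<partial>trans t (at_time X \<tau> \<omega>))) \<partial>P x)
      = (\<integral>\<^sup>+\<omega>. ?e t * (disc \<alpha> (\<tau> \<omega>) * \<phi> (path (enn2real (\<tau> \<omega>) + t) \<omega>)) \<partial>P x)"
      using strong_markov_nn_integral[OF \<alpha> \<tau> _ assms(3), of t x]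
      by (cases "0 \<le> t") (simp_all add: nn_integral_cmult)
  qed
  also have "\<dots> = (\<integral>\<^sup>+\<omega>. (\<integral>\<^sup>+t. ?e t * (disc \<alpha> (\<tau> \<omega>) * \<phi> (path (enn2real (\<tau> \<omega>) + t) \<omega>)) \<partial>lborel) \<partial>P x)"
    by (rule Fubini_P) measurable
  also have "\<dots> = (\<integral>\<^sup>+\<omega>. (\<integral>\<^sup>+t. discounted \<alpha> \<phi> t \<omega> * indicator {\<tau> \<omega>..} (ennreal t) \<partial>lborel) \<partial>P x)"
    by (intro nn_integral_cong shifted_discounted_integral) (simp_all add: space_P)
  finally show ?thesis .
qed

text \<open>Dynkin's formula for potentials. In particular potentials of nonnegative functions
  are \<open>\<alpha>\<close>-excessive along stopping times.\<close>
lemma potential_split_at_stopping_time: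
  assumes \<alpha>: "0 < \<alpha>" and \<tau>: "is_stopping_time F \<tau>" and [measurable]: "\<phi> \<in> borel_measurable borel"
  shows "potential \<alpha> \<phi> x =
      (\<integral>\<^sup>+\<omega>. (\<integral>\<^sup>+t. discounted \<alpha> \<phi> t \<omega> * indicator {..<\<tau> \<omega>} (ennreal t) \<partial>lborel) \<partial>P x)
    + (\<integral>\<^sup>+\<omega>. disc \<alpha> (\<tau> \<omega>) * potential \<alpha> \<phi> (at_time X \<tau> \<omega>) \<partial>P x)"
proof -
  note [measurable] = stopping_time_measurable[OF \<tau>]
  have "potential \<alpha> \<phi> x = (\<integral>\<^sup>+\<omega>. (\<integral>\<^sup>+t. discounted \<alpha> \<phi> t \<omega> * indicator {..<\<tau> \<omega>} (ennreal t)
      + discounted \<alpha> \<phi> t \<omega> * indicator {\<tau> \<omega>..} (ennreal t) \<partial>lborel) \<partial>P x)"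
    unfolding potential_eq[OF assms(3)]
    by (intro nn_integral_cong) (auto split: split_indicator)
  also have "\<dots> = (\<integral>\<^sup>+\<omega>. (\<integral>\<^sup>+t. discounted \<alpha> \<phi> t \<omega> * indicator {..<\<tau> \<omega>} (ennreal t) \<partial>lborel)
      + (\<integral>\<^sup>+t. discounted \<alpha> \<phi> t \<omega> * indicator {\<tau> \<omega>..} (ennreal t) \<partial>lborel) \<partial>P x)"
    by (intro nn_integral_cong nn_integral_add) (simp_all add: space_P indicator_def)
  also have "\<dots> = (\<integral>\<^sup>+\<omega>. (\<integral>\<^sup>+t. discounted \<alpha> \<phi> t \<omega> * indicator {..<\<tau> \<omega>} (ennreal t) \<partial>lborel) \<partial>P x)
      + (\<integral>\<^sup>+\<omega>. (\<integral>\<^sup>+t. discounted \<alpha> \<phi> t \<omega> * indicator {\<tau> \<omega>..} (ennreal t) \<partial>lborel) \<partial>P x)"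
    by (rule nn_integral_add) (simp_all add: indicator_def)
  finally show ?thesis by (simp add: potential_at_stopping_time[OF \<alpha> \<tau>])
qed

end

section \<open>Entry times\<close>

text \<open>The infimum of the times at which the path is in \<open>G\<close>. Since the paths are right-continuous, it is a stopping time
  for open \<open>G\<close>; for a closed half-line this is
  lemma \<open>first_passage_stopping_time\<close>.\<close>
definition entry_time :: "(real \<Rightarrow> 'a \<Rightarrow> real) \<Rightarrow> real set \<Rightarrow> 'a \<Rightarrow> ennreal" where
  "entry_time X G \<omega> = Inf (ennreal ` {t. 0 \<le> t \<and> X t \<omega> \<in> G})"

lemma first_passage_eq_entry_time: "first_passage X b = entry_time X {b..}"
  by (simp add: first_passage_def entry_time_def fun_eq_iff)

lemma entry_time_less_iff:
  "entry_time X G \<omega> < u \<longleftrightarrow> (\<exists>s\<ge>0. ennreal s < u \<and> X s \<omega> \<in> G)"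
  unfolding entry_time_def Inf_less_iff by auto

lemma entry_time_antimono: "G \<subseteq> H \<Longrightarrow> entry_time X H \<omega> \<le> entry_time X G \<omega>"
  unfolding entry_time_def by (intro Inf_superset_mono) auto

lemma entry_time_le: "0 \<le> t \<Longrightarrow> X t \<omega> \<in> G \<Longrightarrow> entry_time X G \<omega> \<le> ennreal t"
  unfolding entry_time_def by (intro Inf_lower) auto

lemma not_in_before_entry_time: "0 \<le> t \<Longrightarrow> ennreal t < entry_time X G \<omega> \<Longrightarrow> X t \<omega> \<notin> G"
  using entry_time_le[of t X \<omega> G] by auto

context standard_markov_process
begin

lemma path_at_entry_time:
  assumes \<omega>: "\<omega> \<in> space M" and r: "0 \<le> r" "entry_time X G \<omega> = ennreal r"
  shows "X r \<omega> \<in> closure G"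
proof (rule ccontr)
  assume out: "X r \<omega> \<notin> closure G"
  have "\<forall>\<^sub>F s in at_right r. X s \<omega> \<in> - closure G"
    by (rule topological_tendstoD[OF right_continuous_paths[OF \<omega> r(1)]]) (use out in auto)
  then obtain d where d: "r < d" "\<And>s. r < s \<Longrightarrow> s < d \<Longrightarrow> X s \<omega> \<notin> closure G"
    by (auto simp: eventually_at_right_field)
  have "entry_time X G \<omega> < ennreal d"
    using r d(1) by (simp add: ennreal_less_iff)
  then obtain s where s: "0 \<le> s" "ennreal s < ennreal d" "X s \<omega> \<in> G"
    unfolding entry_time_less_iff by auto
  have "r \<le> s"
    using entry_time_le[of s X \<omega> G] s r by simp
  moreover have "s < d" using s by (simp add: ennreal_less_iff)
  moreover have "X s \<omega> \<in> closure G" using s(3) closure_subset by blast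
  ultimately show False using out d(2)[of s] by (cases "r = s") auto
qed

lemma entry_time_open_stopping_time:
  assumes G: "open G"
  shows "is_stopping_time F (entry_time X G)"
  unfolding is_stopping_time_def
proof (intro allI impI)
  fix t :: real assume t: "0 \<le> t"
  let ?U = "\<Union>q\<in>{q\<in>\<rat>. 0 \<le> q \<and> q < t}. {\<omega> \<in> space M. X q \<omega> \<in> G}"
  have "{\<omega> \<in> space (F t). entry_time X G \<omega> < ennreal t} = ?U"
  proof safe
    fix \<omega> assume \<omega>: "\<omega> \<in> space (F t)" "entry_time X G \<omega> < ennreal t"
    then have \<omega>M: "\<omega> \<in> space M" by (simp add: space_F t)
    from \<omega>(2) obtain s where s: "0 \<le> s" "s < t" "X s \<omega> \<in> G"
      unfolding entry_time_less_iff by (auto simp: ennreal_less_iff)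
    have "\<forall>\<^sub>F u in at_right s. X u \<omega> \<in> G"
      by (rule topological_tendstoD[OF right_continuous_paths[OF \<omega>M s(1)] G s(3)])
    then obtain d where d: "s < d" "\<And>u. s < u \<Longrightarrow> u < d \<Longrightarrow> X u \<omega> \<in> G"
      by (auto simp: eventually_at_right_field)
    obtain q where q: "q \<in> \<rat>" "s < q" "q < min d t"
      using Rats_dense_in_real[of s "min d t"] d(1) s(2) by auto
    then show "\<omega> \<in> ?U"
      using d(2)[of q] s(1) \<omega>M by (intro UN_I[of q]) auto
  next
    fix \<omega> q assume "\<omega> \<in> space M" "0 \<le> q" "q < t" "X q \<omega> \<in> G"
    then show "\<omega> \<in> space (F t)" "entry_time X G \<omega> < ennreal t"
      by (auto simp: space_F t entry_time_less_iff ennreal_less_iff intro!: exI[of _ q])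
  qed
  moreover have "{\<omega> \<in> space M. X q \<omega> \<in> G} \<in> sets (F t)" if "0 \<le> q" "q < t" for q
  proof -
    have "X q -` G \<inter> space (F q) \<in> sets (F q)"
      using X_adapted[OF that(1)] G by (intro measurable_sets) auto
    moreover have "X q -` G \<inter> space (F q) = {\<omega> \<in> space M. X q \<omega> \<in> G}"
      by (auto simp: space_F that)
    ultimately show ?thesis using mono_F[of q t] that by auto
  qed
  then have "?U \<in> sets (F t)"
    by (intro sets.countable_UN') (auto intro: countable_subset[OF _ countable_rat])
  ultimately show "{\<omega> \<in> space (F t). entry_time X G \<omega> < ennreal t} \<in> sets (F t)" by simp
qed

lemma incseq_SUP_stopping_time:
  assumes T: "\<And>n::nat. is_stopping_time F (T n)"
  shows "is_stopping_time F (\<lambda>\<omega>. SUP n. T n \<omega>)"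
  unfolding is_stopping_time_def
proof (intro allI impI)
  fix t :: real assume t: "0 \<le> t"
  let ?U = "\<Union>q\<in>{q\<in>\<rat>. 0 \<le> q \<and> q < t}. \<Inter>n. {\<omega> \<in> space M. T n \<omega> < ennreal q}"
  have "{\<omega> \<in> space (F t). (SUP n. T n \<omega>) < ennreal t} = ?U"
  proof safe
    fix \<omega> assume \<omega>: "\<omega> \<in> space (F t)" "(SUP n. T n \<omega>) < ennreal t"
    then obtain s where s: "0 \<le> s" "(SUP n. T n \<omega>) = ennreal s"
      by (cases "SUP n. T n \<omega>" rule: ennreal_cases) auto
    with \<omega>(2) have "s < t" by (simp add: ennreal_less_iff)
    then obtain q where q: "q \<in> \<rat>" "s < q" "q < t" using Rats_dense_in_real by blast
    have "T n \<omega> < ennreal q" for n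
    proof -
      have "T n \<omega> \<le> (SUP n. T n \<omega>)" by (rule SUP_upper) simp
      also have "\<dots> < ennreal q" using s q by (simp add: ennreal_less_iff)
      finally show ?thesis .
    qed
    then show "\<omega> \<in> ?U"
      using q s \<omega>(1) by (intro UN_I[of q]) (auto simp: space_F t)
  next
    fix \<omega> q assume q: "0 \<le> q" "q < t" and \<omega>: "\<omega> \<in> (\<Inter>n. {\<omega> \<in> space M. T n \<omega> < ennreal q})"
    then have "(SUP n. T n \<omega>) \<le> ennreal q" by (intro SUP_least) (auto intro: less_imp_le)
    also have "\<dots> < ennreal t" using q by (simp add: ennreal_less_iff)
    finally show "(SUP n. T n \<omega>) < ennreal t" .
    show "\<omega> \<in> space (F t)" using \<omega> by (simp add: space_F t)
  qed
  moreover have "(\<Inter>n. {\<omega> \<in> space M. T n \<omega> < ennreal q}) \<in> sets (F t)" if "0 \<le> q" "q < t" for q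
    using stopping_time_less_in_F[OF T that(1)] mono_F[of q t] that
    by (intro sets.countable_INT) auto
  then have "?U \<in> sets (F t)"
    by (intro sets.countable_UN') (auto intro: countable_subset[OF _ countable_rat])
  ultimately show "{\<omega> \<in> space (F t). (SUP n. T n \<omega>) < ennreal t} \<in> sets (F t)" by simp
qed

text \<open>The exceptional set has to be null under every \<open>P x\<close>, since the completeness of \<open>F t\<close> is assumed
  for such sets only.\<close>
lemma stopping_time_modification:
  assumes \<sigma>: "is_stopping_time F \<sigma>" and eq: "\<And>x. AE \<omega> in P x. \<tau> \<omega> = \<sigma> \<omega>"
    and le: "\<And>\<omega>. \<omega> \<in> space M \<Longrightarrow> \<sigma> \<omega> \<le> \<tau> \<omega>"
  shows "is_stopping_time F \<tau>"
  unfolding is_stopping_time_def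
proof (intro allI impI)
  fix t :: real assume t: "0 \<le> t"
  let ?A = "{\<omega> \<in> space M. \<sigma> \<omega> < ennreal t \<and> \<not> \<tau> \<omega> < ennreal t}"
  have "?A \<in> sets (F t)"
  proof (rule complete[OF t])
    fix x
    obtain N where "{\<omega> \<in> space (P x). \<not> \<tau> \<omega> = \<sigma> \<omega>} \<subseteq> N" "emeasure (P x) N = 0" "N \<in> sets (P x)"
      using eq[of x] by (rule AE_E)
    then show "\<exists>N\<in>null_sets (P x). ?A \<subseteq> N"
      by (intro bexI[of _ N]) (auto simp: space_P)
  qed
  moreover have "{\<omega> \<in> space (F t). \<tau> \<omega> < ennreal t} = {\<omega> \<in> space M. \<sigma> \<omega> < ennreal t} - ?A"
    using le by (auto simp: space_F t intro: le_less_trans)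
  ultimately show "{\<omega> \<in> space (F t). \<tau> \<omega> < ennreal t} \<in> sets (F t)"
    using stopping_time_less_in_F[OF \<sigma> t] by auto
qed

text \<open>The entry times \<open>T n\<close> into the open half-lines \<open>{b - 1/(n+1)<..}\<close> increase to some stopping time
  \<open>\<sigma>\<close> below the first passage time. By quasi-left-continuity \<open>X_\<sigma>\<close> is the limit of the positions at
  \<open>T n\<close>, hence at least \<open>b\<close> almost surely, so that \<open>\<sigma>\<close> is almost surely the first passage time.\<close>
lemma first_passage_stopping_time: "is_stopping_time F (first_passage X b)"
proof -
  define T where "T n = entry_time X {b - inverse (real (Suc n))<..}" for n
  define \<sigma> where "\<sigma> \<omega> = (SUP n. T n \<omega>)" for \<omega>
  have T_stop: "is_stopping_time F (T n)" for n
    unfolding T_def by (rule entry_time_open_stopping_time) simp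
  have \<sigma>_stop: "is_stopping_time F \<sigma>"
    unfolding \<sigma>_def[abs_def] by (rule incseq_SUP_stopping_time) (rule T_stop)
  have inc: "incseq (\<lambda>n. T n \<omega>)" for \<omega>
  proof (rule incseq_SucI)
    fix n
    have "inverse (real (Suc (Suc n))) \<le> inverse (real (Suc n))"
      by (intro le_imp_inverse_le) auto
    then show "T n \<omega> \<le> T (Suc n) \<omega>"
      unfolding T_def by (intro entry_time_antimono) auto
  qed
  \<comment> \<open>The half-lines contain \<open>{b..}\<close>, so they are entered no later than \<open>{b..}\<close>.\<close>
  have "{b..} \<subseteq> {b - inverse (real (Suc n))<..}" for n
  proof -
    have "0 < inverse (real (Suc n))" by simp
    then show ?thesis unfolding atLeast_def greaterThan_def by (intro Collect_mono impI) linarith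
  qed
  then have le: "\<sigma> \<omega> \<le> first_passage X b \<omega>" for \<omega>
    unfolding \<sigma>_def T_def first_passage_eq_entry_time
    by (intro SUP_least entry_time_antimono)
  have "AE \<omega> in P x. first_passage X b \<omega> = \<sigma> \<omega>" for x
  proof -
    have "AE \<omega> in P x. \<sigma> \<omega> < \<infinity> \<longrightarrow> (\<lambda>n. at_time X (T n) \<omega>) \<longlonglongrightarrow> at_time X \<sigma> \<omega>"
      by (rule left_quasi_continuous[OF T_stop \<sigma>_stop inc])
        (simp add: \<sigma>_def LIMSEQ_SUP[OF inc])
    with AE_space show ?thesis
    proof eventually_elim
      case (elim \<omega>)
      then have \<omega>: "\<omega> \<in> space M" by (simp add: space_P)
      have "first_passage X b \<omega> \<le> \<sigma> \<omega>" if fin: "\<sigma> \<omega> < \<infinity>"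
      proof -
        have above: "b - inverse (real (Suc n)) \<le> at_time X (T n) \<omega>" for n
        proof -
          have "T n \<omega> \<le> \<sigma> \<omega>" unfolding \<sigma>_def by (rule SUP_upper) simp
          with fin have "T n \<omega> = ennreal (enn2real (T n \<omega>))"
            by (simp add: less_top le_less_trans)
          then have "at_time X (T n) \<omega> \<in> closure {b - inverse (real (Suc n))<..}"
            unfolding at_time_def T_def by (intro path_at_entry_time[OF \<omega>]) auto
          then show ?thesis by simp
        qed
        have "(\<lambda>n. b - inverse (real (Suc n))) \<longlonglongrightarrow> b - 0"
          by (intro tendsto_intros LIMSEQ_inverse_real_of_nat)
        then have "b \<le> at_time X \<sigma> \<omega>"
          using elim fin above by (intro LIMSEQ_le[of "\<lambda>n. b - inverse (real (Suc n))" b]) auto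
        then have "first_passage X b \<omega> \<le> ennreal (enn2real (\<sigma> \<omega>))"
          unfolding first_passage_eq_entry_time at_time_def by (intro entry_time_le) auto
        then show ?thesis using fin by (simp add: less_top)
      qed
      then show ?case using le[of \<omega>] by (cases "\<sigma> \<omega> = \<infinity>") (auto simp: less_top top_unique)
    qed
  qed
  from stopping_time_modification[OF \<sigma>_stop this le] show ?thesis .
qed

text \<open>A path without negative jumps cannot jump over a level on its way down. Entry into the open
  half-line is used because it is a stopping time by \<open>entry_time_open_stopping_time\<close>.\<close>
lemma downward_passage_hits_level:
  assumes jumps: "no_negative_jumps M X" and \<omega>: "\<omega> \<in> space M"
    and start: "b \<le> X 0 \<omega>" and r: "0 \<le> r" "entry_time X {..<b} \<omega> = ennreal r"
  shows "X r \<omega> = b"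
proof (rule antisym)
  show "X r \<omega> \<le> b"
    using path_at_entry_time[OF \<omega> r] by simp
  show "b \<le> X r \<omega>"
  proof (cases "r = 0")
    case False
    with r have "0 < r" by simp
    then obtain l where l: "((\<lambda>s. X s \<omega>) \<longlongrightarrow> l) (at_left r)"
      using left_limits[OF \<omega>] by auto
    have "\<forall>\<^sub>F s in at_left r. 0 < s \<and> s < r"
      using \<open>0 < r\<close> by (auto simp: eventually_at_left_field intro!: exI[of _ 0])
    then have "\<forall>\<^sub>F s in at_left r. b \<le> X s \<omega>"
    proof eventually_elim
      case (elim s)
      then have "X s \<omega> \<notin> {..<b}"
        by (intro not_in_before_entry_time) (auto simp: r ennreal_less_iff)
      then show ?case by simp
    qed
    then have "b \<le> l"
      by (rule tendsto_lowerbound[OF l]) simp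
    moreover have "Lim (at_left r) (\<lambda>s. X s \<omega>) = l"
      by (rule tendsto_Lim[OF _ l]) simp
    ultimately show ?thesis
      using jumps \<omega> \<open>0 < r\<close> unfolding no_negative_jumps_def by force
  qed (use start in simp)
qed

section \<open>The Green kernel as a potential\<close>

lemma potential_mono:
  assumes "\<And>y. \<phi> y \<le> \<psi> y"
  shows "potential \<alpha> \<phi> x \<le> potential \<alpha> \<psi> x"
  unfolding potential_def discounted_def
  by (intro nn_integral_mono mult_right_mono mult_left_mono assms) auto

lemma potential_eq_pair_integral:
  assumes [measurable]: "\<phi> \<in> borel_measurable borel"
  shows "potential \<alpha> \<phi> x = (\<integral>\<^sup>+p. discounted \<alpha> \<phi> (fst p) (snd p) \<partial>(lborel \<Otimes>\<^sub>M P x))"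
proof -
  interpret pair_sigma_finite lborel "P x" by (rule pair_sigma_finite_lborel_P)
  show ?thesis unfolding potential_def
    using M2.nn_integral_fst[of "\<lambda>p. discounted \<alpha> \<phi> (fst p) (snd p)" lborel] by simp
qed

text \<open>The set function defining the Green kernel is the image under \<open>(t, \<omega>) \<mapsto> X_t(\<omega>)\<close> of the discounted
  product measure, hence countably additive.\<close>
lemma nn_integral_green_kernel:
  assumes \<phi>[measurable]: "\<phi> \<in> borel_measurable borel"
  shows "(\<integral>\<^sup>+y. \<phi> y \<partial>green_kernel P X \<alpha> x) = potential \<alpha> \<phi> x"
proof -
  define D where "D = density (lborel \<Otimes>\<^sub>M P x) (\<lambda>p. ennreal (exp (- \<alpha> * fst p)) * indicator {0..} (fst p))"
  define \<nu> where "\<nu> = distr D borel (\<lambda>p. path (fst p) (snd p))"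
  have [measurable_cong]: "sets D = sets (borel \<Otimes>\<^sub>M M)" by (simp add: D_def sets_P cong: sets_pair_measure_cong)
  have \<nu>: "(\<integral>\<^sup>+y. \<psi> y \<partial>\<nu>) = potential \<alpha> \<psi> x" if [measurable]: "\<psi> \<in> borel_measurable borel" for \<psi>
  proof -
    have "(\<integral>\<^sup>+y. \<psi> y \<partial>\<nu>) = (\<integral>\<^sup>+p. \<psi> (path (fst p) (snd p)) \<partial>D)"
      unfolding \<nu>_def by (rule nn_integral_distr) measurable
    also have "\<dots> = (\<integral>\<^sup>+p. discounted \<alpha> \<psi> (fst p) (snd p) \<partial>(lborel \<Otimes>\<^sub>M P x))"
      unfolding D_def by (subst nn_integral_density) (auto simp: discounted_def mult_ac)
    finally show ?thesis by (simp add: potential_eq_pair_integral)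
  qed
  have "green_kernel P X \<alpha> x = measure_of UNIV (sets borel) (emeasure \<nu>)"
    unfolding green_kernel_def
  proof (rule measure_of_eq)
    fix H :: "real set" assume "H \<in> sigma_sets UNIV (sets borel)"
    then have H[measurable]: "H \<in> sets borel"
      using sets.sigma_sets_eq[of "borel :: real measure"] by simp
    have "emeasure \<nu> H = (\<integral>\<^sup>+y. indicator H y \<partial>\<nu>)" by (simp add: \<nu>_def)
    also have "\<dots> = potential \<alpha> (indicator H) x" by (rule \<nu>) measurable
    also have "\<dots> = (\<integral>\<^sup>+t\<in>{0..}. ennreal (exp (- \<alpha> * t) * transition_prob P X t x H) \<partial>lborel)"
      by (subst potential_trans)
        (auto intro!: nn_integral_cong simp: emeasure_trans ennreal_mult' split: split_indicator)
    finally show "(\<integral>\<^sup>+t\<in>{0..}. ennreal (exp (- \<alpha> * t) * transition_prob P X t x H) \<partial>lborel) = emeasure \<nu> H" ..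
  qed simp
  also have "\<dots> = \<nu>"
    using measure_of_of_measure[of \<nu>] by (simp add: \<nu>_def)
  finally show ?thesis using \<nu>[OF \<phi>] by simp
qed

lemma sets_green_kernel [simp, measurable_cong]: "sets (green_kernel P X \<alpha> x) = sets borel"
  unfolding green_kernel_def
  using sets.sigma_sets_eq[of "borel :: real measure"] by simp

lemma set_integral_green_kernel:
  assumes [measurable]: "f \<in> borel_measurable borel" and nonneg: "\<And>y. b \<le> y \<Longrightarrow> 0 \<le> f y"
  shows "(LINT y:{b..}|green_kernel P X \<alpha> x. f y)
    = enn2real (potential \<alpha> (\<lambda>y. ennreal (f y) * indicator {b..} y) x)"
proof -
  have "(LINT y:{b..}|green_kernel P X \<alpha> x. f y)
      = enn2real (\<integral>\<^sup>+y. ennreal (indicator {b..} y * f y) \<partial>green_kernel P X \<alpha> x)"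
    unfolding set_lebesgue_integral_def real_scaleR_def
    by (rule integral_eq_nn_integral) (auto simp: nonneg split: split_indicator)
  also have "(\<integral>\<^sup>+y. ennreal (indicator {b..} y * f y) \<partial>green_kernel P X \<alpha> x)
      = (\<integral>\<^sup>+y. ennreal (f y) * indicator {b..} y \<partial>green_kernel P X \<alpha> x)"
    by (intro nn_integral_cong) (auto split: split_indicator)
  also have "\<dots> = potential \<alpha> (\<lambda>y. ennreal (f y) * indicator {b..} y) x"
    by (rule nn_integral_green_kernel) measurable
  finally show ?thesis .
qed

section \<open>The reward as a potential\<close>

text \<open>The martingale in the definition of the generator has mean zero, because it vanishes at time 0.\<close>
lemma killed_generator_expectation:
  assumes gen: "killed_generator F P X \<alpha> g a"
    and int: "integrable (lborel \<Otimes>\<^sub>M P x) (\<lambda>(s, \<omega>). indicator {0..} s * (exp (- \<alpha> * s) * a (path s \<omega>)))"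
    and t: "0 \<le> t"
  shows "integrable (P x) (\<lambda>\<omega>. exp (- \<alpha> * t) * g (X t \<omega>))"
    and "(\<integral>\<omega>. exp (- \<alpha> * t) * g (X t \<omega>) \<partial>P x)
      = g x + (\<integral>(s, \<omega>). indicator {0..t} s * (exp (- \<alpha> * s) * a (path s \<omega>)) \<partial>(lborel \<Otimes>\<^sub>M P x))"
proof -
  interpret prob_space "P x" by (rule prob_space_P)
  interpret pair_sigma_finite lborel "P x" by (rule pair_sigma_finite_lborel_P)
  have [measurable]: "g \<in> borel_measurable borel" "a \<in> borel_measurable borel"
    using gen unfolding killed_generator_def by blast+
  have [measurable]: "X 0 \<in> borel_measurable (P x)"
    using path_measurable[of 0] by (simp add: path_eq cong: measurable_cong_sets)
  define J where "J \<omega> = (\<integral>s. indicator {0..t} s * (exp (- \<alpha> * s) * a (path s \<omega>)) \<partial>lborel)" for \<omega>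
  define Y where "Y t \<omega> = exp (- \<alpha> * t) * g (X t \<omega>) - g (X 0 \<omega>)
      - (LINT s:{0..t}|lborel. exp (- \<alpha> * s) * a (X s \<omega>))" for t \<omega>
  have mart: "right_continuous_martingale (P x) F Y"
    using gen unfolding killed_generator_def Y_def[abs_def] by blast
  then have Y_int: "integrable (P x) (Y t)" if "0 \<le> t" for t
    using that unfolding right_continuous_martingale_def by blast
  have sub: "subalgebra (P x) (F 0)"
    using subalgebra_F[of 0] by (simp add: subalgebra_def space_P sets_P)
  interpret sigma_finite_subalgebra "P x" "F 0"
    by (rule sigma_finite_subalgebra_P[OF sub])
  have Y0: "Y 0 \<omega> = 0" for \<omega>
  proof -
    have "(LINT s:{0..0}|lborel. exp (- \<alpha> * s) * a (X s \<omega>)) = 0"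
      unfolding set_lebesgue_integral_def
      by (rule integral_eq_zero_AE) (use AE_lborel_singleton[of "0::real"] in \<open>eventually_elim, auto\<close>)
    then show ?thesis by (simp add: Y_def)
  qed
  have "AE \<omega> in P x. real_cond_exp (P x) (F 0) (Y t) \<omega> = Y 0 \<omega>"
    using mart t unfolding right_continuous_martingale_def by simp
  then have "(\<integral>\<omega>. real_cond_exp (P x) (F 0) (Y t) \<omega> \<partial>P x) = (\<integral>\<omega>. Y 0 \<omega> \<partial>P x)"
    using real_cond_exp_int(1)[OF Y_int[OF t]] Y_int[of 0] by (intro integral_cong_AE) auto
  then have Y_mean: "(\<integral>\<omega>. Y t \<omega> \<partial>P x) = 0"
    using real_cond_exp_int(2)[OF Y_int[OF t]] by (simp add: Y0)
  have int_t: "integrable (lborel \<Otimes>\<^sub>M P x) (\<lambda>(s, \<omega>). indicator {0..t} s * (exp (- \<alpha> * s) * a (path s \<omega>)))"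
    by (rule Bochner_Integration.integrable_bound[OF int]) (auto split: split_indicator)
  have J_int: "integrable (P x) J"
    unfolding J_def by (rule integrable_snd[OF int_t])
  have J_mean: "(\<integral>\<omega>. J \<omega> \<partial>P x) = (\<integral>(s, \<omega>). indicator {0..t} s * (exp (- \<alpha> * s) * a (path s \<omega>)) \<partial>(lborel \<Otimes>\<^sub>M P x))"
    unfolding J_def by (rule integral_snd[OF int_t])
  have g0: "AE \<omega> in P x. g (X 0 \<omega>) = g x"
    using start by eventually_elim simp
  have g0_int: "integrable (P x) (\<lambda>\<omega>. g (X 0 \<omega>))"
    by (subst integrable_cong_AE[OF _ _ g0]) auto
  have g0_mean: "(\<integral>\<omega>. g (X 0 \<omega>) \<partial>P x) = g x"
    by (subst integral_cong_AE[OF _ _ g0]) (auto simp: prob_space)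
  have "(LINT s:{0..t}|lborel. exp (- \<alpha> * s) * a (X s \<omega>)) = J \<omega>" for \<omega>
    unfolding set_lebesgue_integral_def J_def
    by (intro Bochner_Integration.integral_cong) (auto simp: path_eq split: split_indicator)
  then have eq: "exp (- \<alpha> * t) * g (X t \<omega>) = Y t \<omega> + g (X 0 \<omega>) + J \<omega>" for \<omega>
    by (simp add: Y_def)
  show "integrable (P x) (\<lambda>\<omega>. exp (- \<alpha> * t) * g (X t \<omega>))"
    unfolding eq by (intro Bochner_Integration.integrable_add Y_int t g0_int J_int)
  show "(\<integral>\<omega>. exp (- \<alpha> * t) * g (X t \<omega>) \<partial>P x)
      = g x + (\<integral>(s, \<omega>). indicator {0..t} s * (exp (- \<alpha> * s) * a (path s \<omega>)) \<partial>(lborel \<Otimes>\<^sub>M P x))"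
    unfolding eq using Y_int[OF t] g0_int J_int by (simp add: Y_mean g0_mean J_mean)
qed

text \<open>\<open>g\<close> is the potential of \<open>- a\<close>, obtained by letting \<open>t\<close> tend to infinity in
  \<open>killed_generator_expectation\<close>. The two parts are finite by assumption, so their difference makes sense.\<close>
lemma reward_eq_potential:
  assumes gen: "killed_generator F P X \<alpha> g a" and g: "\<And>y. 0 \<le> g y"
    and vanish: "((\<lambda>t. \<integral>\<^sup>+\<omega>. ennreal (exp (- \<alpha> * t) * g (X t \<omega>)) \<partial>P x) \<longlongrightarrow> 0) at_top"
    and fin: "potential \<alpha> (\<lambda>y. ennreal \<bar>a y\<bar>) x < \<infinity>"
  shows "g x = enn2real (potential \<alpha> (\<lambda>y. ennreal (- a y)) x) - enn2real (potential \<alpha> (\<lambda>y. ennreal (a y)) x)"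
proof -
  let ?N = "lborel \<Otimes>\<^sub>M P x"
  interpret pair_sigma_finite lborel "P x" by (rule pair_sigma_finite_lborel_P)
  have [measurable]: "g \<in> borel_measurable borel" "a \<in> borel_measurable borel"
    using gen unfolding killed_generator_def by blast+
  define w where "w p = indicator {0..} (fst p) * (exp (- \<alpha> * fst p) * a (path (fst p) (snd p)))" for p
  define I where "I t = (\<integral>p. indicator {0..t} (fst p) * w p \<partial>?N)" for t
  have w_meas [measurable]: "w \<in> borel_measurable ?N" unfolding w_def by measurable
  have nn: "(\<integral>\<^sup>+p. ennreal (indicator {0..} (fst p) * (exp (- \<alpha> * fst p) * b (path (fst p) (snd p)))) \<partial>?N)
      = potential \<alpha> (\<lambda>y. ennreal (b y)) x" if [measurable]: "b \<in> borel_measurable borel" for b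
    unfolding potential_eq_pair_integral[of "\<lambda>y. ennreal (b y)", simplified]
    by (intro nn_integral_cong) (auto simp: discounted_def ennreal_mult' split: split_indicator)
  have "ennreal (norm (w p)) = ennreal (indicator {0..} (fst p) * (exp (- \<alpha> * fst p) * \<bar>a (path (fst p) (snd p))\<bar>))" for p
    by (simp add: w_def abs_mult)
  then have w_int: "integrable ?N w"
    using fin nn[of "\<lambda>y. \<bar>a y\<bar>"] by (intro integrableI_bounded) simp_all
  have w_mean: "(\<integral>p. w p \<partial>?N) = enn2real (potential \<alpha> (\<lambda>y. ennreal (a y)) x) - enn2real (potential \<alpha> (\<lambda>y. ennreal (- a y)) x)"
    using nn[of a] nn[of "\<lambda>y. - a y"] unfolding real_lebesgue_integral_def[OF w_int]
    by (simp add: w_def)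
  have "(I \<longlongrightarrow> (\<integral>p. w p \<partial>?N)) at_top"
    unfolding I_def
  proof (rule integral_dominated_convergence_at_top[where w="\<lambda>p. norm (w p)"])
    show "AE p in ?N. ((\<lambda>t. indicator {0..t} (fst p) * w p) \<longlongrightarrow> w p) at_top"
    proof (intro AE_I2 tendsto_eventually)
      fix p
      show "\<forall>\<^sub>F t in at_top. indicator {0..t} (fst p) * w p = w p"
        using eventually_ge_at_top[of "fst p"]
        by eventually_elim (auto simp: w_def split: split_indicator)
    qed
  qed (use w_int in \<open>auto split: split_indicator\<close>)
  then have lim: "((\<lambda>t. g x + I t) \<longlongrightarrow> g x + (\<integral>p. w p \<partial>?N)) at_top"
    by (intro tendsto_intros)
  have mean: "(\<integral>\<^sup>+\<omega>. ennreal (exp (- \<alpha> * t) * g (X t \<omega>)) \<partial>P x) = ennreal (g x + I t)"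
    and pos: "0 \<le> g x + I t" if t: "0 \<le> t" for t
  proof -
    have int: "integrable ?N (\<lambda>(s, \<omega>). indicator {0..} s * (exp (- \<alpha> * s) * a (path s \<omega>)))"
      using w_int unfolding w_def[abs_def] split_beta' .
    note * = killed_generator_expectation[OF gen int t]
    have "(\<integral>(s, \<omega>). indicator {0..t} s * (exp (- \<alpha> * s) * a (path s \<omega>)) \<partial>?N) = I t"
      unfolding I_def by (intro Bochner_Integration.integral_cong) (auto simp: w_def split: split_indicator)
    with *(2) have mean_t: "(\<integral>\<omega>. exp (- \<alpha> * t) * g (X t \<omega>) \<partial>P x) = g x + I t" by simp
    then show "(\<integral>\<^sup>+\<omega>. ennreal (exp (- \<alpha> * t) * g (X t \<omega>)) \<partial>P x) = ennreal (g x + I t)"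
      by (subst nn_integral_eq_integral[OF *(1)]) (auto simp: g)
    have "0 \<le> (\<integral>\<omega>. exp (- \<alpha> * t) * g (X t \<omega>) \<partial>P x)" by (simp add: g)
    then show "0 \<le> g x + I t" by (simp only: mean_t)
  qed
  have "((\<lambda>t. ennreal (g x + I t)) \<longlongrightarrow> 0) at_top"
  proof (rule Lim_transform_eventually[OF vanish])
    show "\<forall>\<^sub>F t in at_top. (\<integral>\<^sup>+\<omega>. ennreal (exp (- \<alpha> * t) * g (X t \<omega>)) \<partial>P x) = ennreal (g x + I t)"
      using eventually_ge_at_top[of "0::real"] by eventually_elim (rule mean)
  qed
  moreover have "((\<lambda>t. ennreal (g x + I t)) \<longlongrightarrow> ennreal (g x + (\<integral>p. w p \<partial>?N))) at_top"
    by (rule tendsto_ennrealI[OF lim])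
  ultimately have "ennreal (g x + (\<integral>p. w p \<partial>?N)) = 0"
    by (intro tendsto_unique[OF trivial_limit_at_top_linorder])
  then have "g x + (\<integral>p. w p \<partial>?N) \<le> 0" by (simp add: ennreal_eq_0_iff)
  moreover have "0 \<le> g x + (\<integral>p. w p \<partial>?N)"
    by (rule tendsto_lowerbound[OF lim])
      (use eventually_ge_at_top[of "0::real"] in \<open>eventually_elim, simp add: pos\<close>, simp)
  ultimately show ?thesis by (simp add: w_mean)
qed

section \<open>Verification of the threshold\<close>

lemma potential_after_downward_passage:
  assumes jumps: "no_negative_jumps M X" and x: "b \<le> x"
  shows "(\<integral>\<^sup>+\<omega>. disc \<alpha> (entry_time X {..<b} \<omega>) * potential \<alpha> \<phi> (at_time X (entry_time X {..<b}) \<omega>) \<partial>P x)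
    = potential \<alpha> \<phi> b * (\<integral>\<^sup>+\<omega>. disc \<alpha> (entry_time X {..<b} \<omega>) \<partial>P x)"
proof -
  have [measurable]: "entry_time X {..<b} \<in> borel_measurable M"
    by (intro stopping_time_measurable entry_time_open_stopping_time) simp
  have "AE \<omega> in P x. disc \<alpha> (entry_time X {..<b} \<omega>) * potential \<alpha> \<phi> (at_time X (entry_time X {..<b}) \<omega>)
      = potential \<alpha> \<phi> b * disc \<alpha> (entry_time X {..<b} \<omega>)"
    using AE_space start[of x]
  proof eventually_elim
    case (elim \<omega>)
    show ?case
    proof (cases "entry_time X {..<b} \<omega>" rule: ennreal_cases)
      case (real r)
      have "X r \<omega> = b"
        by (rule downward_passage_hits_level[OF jumps _ _ real]) (use elim x in \<open>simp_all add: space_P\<close>)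
      then show ?thesis using real by (simp add: at_time_def mult.commute)
    qed (simp add: disc_def)
  qed
  then have "(\<integral>\<^sup>+\<omega>. disc \<alpha> (entry_time X {..<b} \<omega>) * potential \<alpha> \<phi> (at_time X (entry_time X {..<b}) \<omega>) \<partial>P x)
      = (\<integral>\<^sup>+\<omega>. potential \<alpha> \<phi> b * disc \<alpha> (entry_time X {..<b} \<omega>) \<partial>P x)"
    by (rule nn_integral_cong_AE)
  also have "\<dots> = potential \<alpha> \<phi> b * (\<integral>\<^sup>+\<omega>. disc \<alpha> (entry_time X {..<b} \<omega>) \<partial>P x)"
    by (rule nn_integral_cmult) measurable
  finally show ?thesis .
qed

lemma disc_le_1: "0 < \<alpha> \<Longrightarrow> disc \<alpha> u \<le> 1"
  by (auto simp: disc_def ennreal_le_1)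

text \<open>Stop at the first time \<open>\<rho>\<close> below \<open>b\<close>. Before \<open>\<rho>\<close> the functions \<open>f\<close> and \<open>f\<close> truncated to \<open>{b..}\<close>
  accumulate the same amount \<open>A\<close>, and at \<open>\<rho>\<close>, if finite, the process is almost surely at \<open>b\<close>, where the two potentials agree by
  \<open>eq\<close>. The expected discount factor \<open>K\<close> at \<open>\<rho>\<close> therefore multiplies the same value on both sides.
  The positive and the negative part of \<open>f\<close> are treated separately, since potentials are defined for
  nonnegative functions.\<close>
lemma truncated_potential_eq_above_level:
  assumes \<alpha>: "0 < \<alpha>" and jumps: "no_negative_jumps M X"
    and [measurable]: "f \<in> borel_measurable borel" and pos: "\<And>y. b \<le> y \<Longrightarrow> 0 \<le> f y"
    and fin: "\<And>x. potential \<alpha> (\<lambda>y. ennreal \<bar>f y\<bar>) x < \<infinity>"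
    and g: "\<And>x. g x = enn2real (potential \<alpha> (\<lambda>y. ennreal (f y)) x) - enn2real (potential \<alpha> (\<lambda>y. ennreal (- f y)) x)"
    and eq: "g b = enn2real (potential \<alpha> (\<lambda>y. ennreal (f y) * indicator {b..} y) b)"
    and x: "b \<le> x"
  shows "g x = enn2real (potential \<alpha> (\<lambda>y. ennreal (f y) * indicator {b..} y) x)"
proof -
  let ?\<rho> = "entry_time X {..<b}"
  let ?fp = "\<lambda>y. ennreal (f y)" and ?fm = "\<lambda>y. ennreal (- f y)" and ?ft = "\<lambda>y. ennreal (f y) * indicator {b..} y"
  define K where "K = (\<integral>\<^sup>+\<omega>. disc \<alpha> (?\<rho> \<omega>) \<partial>P x)"
  define A where "A \<phi> = (\<integral>\<^sup>+\<omega>. (\<integral>\<^sup>+t. discounted \<alpha> \<phi> t \<omega> * indicator {..<?\<rho> \<omega>} (ennreal t) \<partial>lborel) \<partial>P x)" for \<phi>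
  have \<rho>: "is_stopping_time F ?\<rho>"
    by (rule entry_time_open_stopping_time) simp
  have split: "potential \<alpha> \<phi> x = A \<phi> + potential \<alpha> \<phi> b * K" if [measurable]: "\<phi> \<in> borel_measurable borel" for \<phi>
    using potential_split_at_stopping_time[OF \<alpha> \<rho> that, of x]
    by (simp add: A_def K_def potential_after_downward_passage[OF jumps x])
  have above: "b \<le> path t \<omega>" if "0 \<le> t" "ennreal t < ?\<rho> \<omega>" for t \<omega>
    using not_in_before_entry_time[OF that] that(1) by (simp add: path_eq)
  have A_eq: "A ?fp = A ?ft" "A ?fm = 0"
  proof -
    have "discounted \<alpha> ?fp t \<omega> * indicator {..<?\<rho> \<omega>} (ennreal t) = discounted \<alpha> ?ft t \<omega> * indicator {..<?\<rho> \<omega>} (ennreal t)"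
      "discounted \<alpha> ?fm t \<omega> * indicator {..<?\<rho> \<omega>} (ennreal t) = 0" for t \<omega>
      using above[of t \<omega>] pos[of "path t \<omega>"] by (auto simp: discounted_def ennreal_neg split: split_indicator)
    then show "A ?fp = A ?ft" "A ?fm = 0" unfolding A_def by (simp_all only: nn_integral_const mult_zero_left)
  qed
  have dominated: "potential \<alpha> \<phi> z < \<infinity>" if "\<And>y. \<phi> y \<le> ennreal \<bar>f y\<bar>" for \<phi> z
    by (rule le_less_trans[OF potential_mono[OF that] fin])
  have fin': "potential \<alpha> ?fp z < \<infinity>" "potential \<alpha> ?fm z < \<infinity>" "potential \<alpha> ?ft z < \<infinity>" for z
    by (rule dominated, force intro!: ennreal_leI abs_ge_self split: split_indicator)+
  have K_fin: "K < \<infinity>"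
  proof -
    interpret prob_space "P x" by (rule prob_space_P)
    have "K \<le> (\<integral>\<^sup>+\<omega>. 1 \<partial>P x)" unfolding K_def by (intro nn_integral_mono disc_le_1 \<alpha>)
    also have "\<dots> < \<infinity>" by (simp add: emeasure_space_1)
    finally show ?thesis .
  qed
  have A_fin: "A ?ft < \<infinity>"
    using fin'(3)[of x] split[of ?ft] by (auto simp: less_top)
  \<comment> \<open>All terms are finite, so the decomposition may be read in the reals and subtracted.\<close>
  have real_split: "enn2real (potential \<alpha> \<phi> x) = enn2real (A \<phi>) + enn2real (potential \<alpha> \<phi> b) * enn2real K"
    if "\<phi> \<in> borel_measurable borel" "A \<phi> < \<infinity>" "potential \<alpha> \<phi> b < \<infinity>" for \<phi>
    using split[OF that(1)] that K_fin by (simp add: enn2real_plus enn2real_mult ennreal_mult_less_top)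
  have "g x = enn2real (A ?ft) + (enn2real (potential \<alpha> ?fp b) - enn2real (potential \<alpha> ?fm b)) * enn2real K"
    unfolding g[of x] using A_fin fin'
    by (subst (1 2) real_split) (simp_all add: A_eq algebra_simps)
  also have "\<dots> = enn2real (A ?ft) + enn2real (potential \<alpha> ?ft b) * enn2real K"
    using g[of b] eq by simp
  also have "\<dots> = enn2real (potential \<alpha> ?ft x)"
    using A_fin fin' by (subst real_split) simp_all
  finally show ?thesis .
qed

lemma expected_reward_eq:
  assumes "\<And>y. 0 \<le> g y"
  shows "expected_reward P X \<alpha> g x \<tau> = (\<integral>\<^sup>+\<omega>. disc \<alpha> (\<tau> \<omega>) * ennreal (g (at_time X \<tau> \<omega>)) \<partial>P x)"
  unfolding expected_reward_def discounted_reward_def disc_def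
  by (intro nn_integral_cong) (auto simp: ennreal_mult assms)

lemma expected_reward_le_potential:
  assumes \<alpha>: "0 < \<alpha>" and \<tau>: "is_stopping_time F \<tau>" and \<phi>: "\<phi> \<in> borel_measurable borel"
    and g: "\<And>y. 0 \<le> g y" and le: "\<And>y. ennreal (g y) \<le> potential \<alpha> \<phi> y"
  shows "expected_reward P X \<alpha> g x \<tau> \<le> potential \<alpha> \<phi> x"
proof -
  have "expected_reward P X \<alpha> g x \<tau> \<le> (\<integral>\<^sup>+\<omega>. disc \<alpha> (\<tau> \<omega>) * potential \<alpha> \<phi> (at_time X \<tau> \<omega>) \<partial>P x)"
    unfolding expected_reward_eq[OF g] by (intro nn_integral_mono mult_left_mono le) simp
  also have "\<dots> \<le> potential \<alpha> \<phi> x"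
    unfolding potential_split_at_stopping_time[OF \<alpha> \<tau> \<phi>, of x] by simp
  finally show ?thesis .
qed

text \<open>Since \<open>\<phi>\<close> vanishes below \<open>b\<close>, nothing is accumulated before the first passage, and at the first
  passage the process is in \<open>{b..}\<close>, where \<open>g\<close> is the potential of \<open>\<phi>\<close>.\<close>
lemma expected_reward_first_passage:
  assumes \<alpha>: "0 < \<alpha>" and \<phi>: "\<phi> \<in> borel_measurable borel" and zero: "\<And>y. y < b \<Longrightarrow> \<phi> y = 0"
    and g: "\<And>y. 0 \<le> g y" and eq: "\<And>y. b \<le> y \<Longrightarrow> ennreal (g y) = potential \<alpha> \<phi> y"
  shows "expected_reward P X \<alpha> g x (first_passage X b) = potential \<alpha> \<phi> x"
proof -
  let ?\<tau> = "first_passage X b"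
  have "discounted \<alpha> \<phi> t \<omega> * indicator {..<?\<tau> \<omega>} (ennreal t) = 0" for t \<omega>
  proof (cases "0 \<le> t \<and> ennreal t < ?\<tau> \<omega>")
    case True
    then have "X t \<omega> \<notin> {b..}"
      unfolding first_passage_eq_entry_time by (intro not_in_before_entry_time) auto
    then show ?thesis using True by (simp add: discounted_def path_eq zero)
  qed (auto simp: discounted_def split: split_indicator)
  then have "potential \<alpha> \<phi> x = (\<integral>\<^sup>+\<omega>. disc \<alpha> (?\<tau> \<omega>) * potential \<alpha> \<phi> (at_time X ?\<tau> \<omega>) \<partial>P x)"
    unfolding potential_split_at_stopping_time[OF \<alpha> first_passage_stopping_time[of b] \<phi>, of x]
    by (simp only: nn_integral_const mult_zero_left add_0_left)
  also have "\<dots> = (\<integral>\<^sup>+\<omega>. disc \<alpha> (?\<tau> \<omega>) * ennreal (g (at_time X ?\<tau> \<omega>)) \<partial>P x)"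
  proof (rule nn_integral_cong)
    fix \<omega> assume \<omega>: "\<omega> \<in> space (P x)"
    show "disc \<alpha> (?\<tau> \<omega>) * potential \<alpha> \<phi> (at_time X ?\<tau> \<omega>) = disc \<alpha> (?\<tau> \<omega>) * ennreal (g (at_time X ?\<tau> \<omega>))"
    proof (cases "?\<tau> \<omega>" rule: ennreal_cases)
      case (real r)
      then have "X r \<omega> \<in> closure {b..}"
        using \<omega> unfolding first_passage_eq_entry_time by (intro path_at_entry_time) (simp_all add: space_P)
      then show ?thesis using real by (simp add: at_time_def eq)
    qed (simp add: disc_def)
  qed
  finally show ?thesis by (simp add: expected_reward_eq[OF g])
qed

end

theorem mainTheorem2:
  fixes M :: "'a measure"
    and F :: "real \<Rightarrow> 'a measure"
    and P :: "real \<Rightarrow> 'a measure"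
    and X :: "real \<Rightarrow> 'a \<Rightarrow> real"
    and \<alpha> xstar :: real
    and g Ag f V :: "real \<Rightarrow> real"
  assumes "standard_markov_process M F P X"
    and "no_negative_jumps M X"
    and "\<alpha> > 0"
    and "continuous_on UNIV g"
    and "\<And>y. g y \<ge> 0"
    and "killed_generator F P X \<alpha> g Ag"
    and f_def: "f = (\<lambda>y. - Ag y)"
    and "\<And>x. ((\<lambda>t. \<integral>\<^sup>+\<omega>. ennreal (exp (- \<alpha> * t) * g (X t \<omega>)) \<partial>P x) \<longlongrightarrow> 0) at_top"
    and "\<And>x. (\<integral>\<^sup>+\<omega>. (\<integral>\<^sup>+s\<in>{0..}. ennreal (exp (- \<alpha> * s) * \<bar>f (X s \<omega>)\<bar>) \<partial>lborel) \<partial>P x) < \<infinity>"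
    and "g xstar = (LINT y:{xstar..}|green_kernel P X \<alpha> xstar. f y)"
    and "\<And>y. y \<ge> xstar \<Longrightarrow> f y \<ge> 0"
    and V_def: "V = (\<lambda>x. LINT y:{xstar..}|green_kernel P X \<alpha> x. f y)"
    and "\<And>x. x \<le> xstar \<Longrightarrow> V x \<ge> g x"
  shows "is_stopping_time F (first_passage X xstar) \<and>
    (\<forall>x. ennreal (V x) = (SUP \<tau>\<in>{\<tau>. is_stopping_time F \<tau>}. expected_reward P X \<alpha> g x \<tau>) \<and>
         ennreal (V x) = expected_reward P X \<alpha> g x (first_passage X xstar))"
proof -
  interpret standard_markov_process M F P X by fact
  let ?\<phi> = "\<lambda>y. ennreal (f y) * indicator {xstar..} y"
  note \<alpha> = \<open>\<alpha> > 0\<close> and g_nonneg = \<open>\<And>y. g y \<ge> 0\<close> and f_nonneg = \<open>\<And>y. y \<ge> xstar \<Longrightarrow> f y \<ge> 0\<close>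
    and gen = \<open>killed_generator F P X \<alpha> g Ag\<close>
  have [measurable]: "Ag \<in> borel_measurable borel"
    using gen unfolding killed_generator_def by blast
  then have f_meas [measurable]: "f \<in> borel_measurable borel" by (simp add: f_def)
  have fin: "potential \<alpha> (\<lambda>y. ennreal \<bar>f y\<bar>) x < \<infinity>" for x
  proof -
    have "potential \<alpha> (\<lambda>y. ennreal \<bar>f y\<bar>) x
      = (\<integral>\<^sup>+\<omega>. (\<integral>\<^sup>+s\<in>{0..}. ennreal (exp (- \<alpha> * s) * \<bar>f (X s \<omega>)\<bar>) \<partial>lborel) \<partial>P x)"
      by (subst potential_eq)
        (auto intro!: nn_integral_cong simp: discounted_def path_eq ennreal_mult split: split_indicator)
    then show ?thesis using assms(9)[of x] by simp
  qed
  have g_eq: "g x = enn2real (potential \<alpha> (\<lambda>y. ennreal (f y)) x) - enn2real (potential \<alpha> (\<lambda>y. ennreal (- f y)) x)" for x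
    using reward_eq_potential[OF gen g_nonneg assms(8), of x] fin[of x] by (simp add: f_def)
  have V_eq: "V x = enn2real (potential \<alpha> ?\<phi> x)" for x
    unfolding V_def by (rule set_integral_green_kernel[OF f_meas f_nonneg])
  have V_potential: "ennreal (V x) = potential \<alpha> ?\<phi> x" for x
  proof -
    have "potential \<alpha> ?\<phi> x \<le> potential \<alpha> (\<lambda>y. ennreal \<bar>f y\<bar>) x"
      by (rule potential_mono) (auto intro!: ennreal_leI split: split_indicator)
    then have "potential \<alpha> ?\<phi> x < \<infinity>" using fin[of x] by (rule le_less_trans)
    then show ?thesis unfolding V_eq by simp
  qed
  have g_xstar: "g xstar = enn2real (potential \<alpha> ?\<phi> xstar)"
    using assms(10) V_eq[of xstar] by (simp add: V_def)
  have g_V: "g x = V x" if "xstar \<le> x" for x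
    unfolding V_eq
    by (rule truncated_potential_eq_above_level[OF \<alpha> \<open>no_negative_jumps M X\<close> f_meas f_nonneg fin g_eq g_xstar that])
  have g_le: "ennreal (g x) \<le> potential \<alpha> ?\<phi> x" for x
    unfolding V_potential[symmetric]
    using assms(13)[of x] g_V[of x] by (intro ennreal_leI) (cases "x \<le> xstar"; simp)
  have upper: "expected_reward P X \<alpha> g x \<tau> \<le> ennreal (V x)" if "is_stopping_time F \<tau>" for x \<tau>
    unfolding V_potential
    by (rule expected_reward_le_potential[OF \<alpha> that _ g_nonneg g_le]) measurable
  have attained: "expected_reward P X \<alpha> g x (first_passage X xstar) = ennreal (V x)" for x
    unfolding V_potential
    by (rule expected_reward_first_passage[OF \<alpha> _ _ g_nonneg]) (auto simp: V_potential[symmetric] g_V)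
  have "ennreal (V x) = (SUP \<tau>\<in>{\<tau>. is_stopping_time F \<tau>}. expected_reward P X \<alpha> g x \<tau>)" for x
  proof (rule antisym)
    show "ennreal (V x) \<le> (SUP \<tau>\<in>{\<tau>. is_stopping_time F \<tau>}. expected_reward P X \<alpha> g x \<tau>)"
      unfolding attained[symmetric] by (rule SUP_upper) (simp add: first_passage_stopping_time)
    show "(SUP \<tau>\<in>{\<tau>. is_stopping_time F \<tau>}. expected_reward P X \<alpha> g x \<tau>) \<le> ennreal (V x)"
      by (rule SUP_least) (simp add: upper)
  qed
  then show ?thesis by (simp add: attained first_passage_stopping_time)
qed

end
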